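(* Let $\omega$ be an open strict interval of $\mathbb T$. For every $T,T'>0$, $\mathcal{NC}_{H^2}(\omega,T) = \mathcal{NC}_{H^2}(\omega,T')$.
   Context: $\mathbb T$ is the complex unit circle, identified with $\mathbb R/2\pi\mathbb Z$ via $x\mapsto e^{ix}$. An open strict interval of $\mathbb T$ is an open arc $\{e^{ix}:a<x<b\}$ with $0<b-a<2\pi$. Functions are complex valued; $f\in L^2(\mathbb T)$ is written $f(e^{ix})=\sum_{n\in\mathbb Z}\widehat f(n)e^{inx}$. The Riesz projector is $P_+f(e^{ix})=\sum_{n\ge 0}\widehat f(n)e^{inx}$, and $H^2=P_+L^2(\mathbb T)$. Let $S(t)f(e^{ix})=\sum_{n}\widehat f(n)e^{-|n|t}e^{inx}$ (the semigroup generated by $-|D|$, $|D|f=\sum_n|n|\widehat f(n)e^{inx}$). The $H^2$ control system is $(\partial_t+|D|)f(t,e^{ix})=P_+\mathbf 1_\omega u(t,e^{ix})$, $f(0,\cdot)=f_0\in H^2$, with control $u\in L^2([0,T]\times\omega)$; its solution satisfies $f(T,\cdot)=S(T)f_0+\int_0^TS(T-s)P_+(\mathbf 1_\omega u(s,\cdot))\,ds$, where $\mathbf 1_\omega u$ denotes the extension of $u$ by $0$ outside $\omega$. $\mathcal{NC}_{H^2}(\omega,T)$ is the set of $f_0\in H^2$ for which there is $u\in L^2([0,T]\times\omega)$ with $f(T,\cdot)=0$. *)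

theory Defs
  imports "HOL-Analysis.Analysis"
begin

section \<open>Square integrable functions\<close>

definition square_integrable :: "'a measure \<Rightarrow> ('a \<Rightarrow> complex) \<Rightarrow> bool" where
  "square_integrable M f \<longleftrightarrow>
     f \<in> borel_measurable M \<and> integrable M (\<lambda>x. (cmod (f x))\<^sup>2)"

lemma square_integrable_measurable [measurable_dest]:
  "square_integrable M f \<Longrightarrow> f \<in> borel_measurable M"
  by (simp add: square_integrable_def)

lemma square_integrable_zero [simp]: "square_integrable M (\<lambda>_. 0)"
  by (simp add: square_integrable_def)

lemma square_integrable_bound:
  assumes f: "f \<in> borel_measurable M" and w: "integrable M w"
    and le: "AE x in M. (cmod (f x))\<^sup>2 \<le> w x"
  shows "square_integrable M f"
  unfolding square_integrable_def
proof
  show "integrable M (\<lambda>x. (cmod (f x))\<^sup>2)"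
    by (rule Bochner_Integration.integrable_bound[OF w]) (use f le in auto)
qed (rule f)

lemma cmod_add_sq: "(cmod (a + b))\<^sup>2 \<le> 2 * (cmod a)\<^sup>2 + 2 * (cmod b)\<^sup>2"
proof -
  have "(cmod (a + b))\<^sup>2 \<le> (cmod a + cmod b)\<^sup>2"
    by (simp add: norm_triangle_ineq power_mono)
  also have "\<dots> \<le> 2 * (cmod a)\<^sup>2 + 2 * (cmod b)\<^sup>2"
    using sum_squares_bound[of "cmod a" "cmod b"] by (simp add: power2_sum)
  finally show ?thesis .
qed

lemma square_integrable_add:
  assumes "square_integrable M f" "square_integrable M g"
  shows "square_integrable M (\<lambda>x. f x + g x)"
  by (rule square_integrable_bound[where w = "\<lambda>x. 2 * (cmod (f x))\<^sup>2 + 2 * (cmod (g x))\<^sup>2"])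
    (use assms cmod_add_sq in \<open>auto simp: square_integrable_def\<close>)

lemma square_integrable_cmult:
  assumes "square_integrable M f"
  shows "square_integrable M (\<lambda>x. c * f x)"
  using assms by (auto simp: square_integrable_def norm_mult power_mult_distrib)

lemma square_integrable_scaleR:
  assumes "square_integrable M f"
  shows "square_integrable M (\<lambda>x. c *\<^sub>R f x)"
  using square_integrable_cmult[OF assms, of "of_real c"] by (simp add: scaleR_conv_of_real)

lemma square_integrable_minus:
  assumes "square_integrable M f"
  shows "square_integrable M (\<lambda>x. - f x)"
  using square_integrable_cmult[OF assms, of "-1"] by simp

lemma square_integrable_diff:
  assumes "square_integrable M f" "square_integrable M g"
  shows "square_integrable M (\<lambda>x. f x - g x)"
  using square_integrable_add[OF assms(1) square_integrable_minus[OF assms(2)]] by simp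

lemma square_integrable_integrable_mult:
  assumes "square_integrable M f" "square_integrable M g"
  shows "integrable M (\<lambda>x. f x * g x)"
proof (rule Bochner_Integration.integrable_bound[where f = "\<lambda>x. (cmod (f x))\<^sup>2 + (cmod (g x))\<^sup>2"])
  show "integrable M (\<lambda>x. (cmod (f x))\<^sup>2 + (cmod (g x))\<^sup>2)"
    using assms by (auto simp: square_integrable_def)
  show "AE x in M. norm (f x * g x) \<le> norm ((cmod (f x))\<^sup>2 + (cmod (g x))\<^sup>2)"
  proof (rule AE_I2)
    fix x
    have "cmod (f x) * cmod (g x) \<ge> 0" by simp
    then have "cmod (f x) * cmod (g x) \<le> (cmod (f x))\<^sup>2 + (cmod (g x))\<^sup>2"
      using sum_squares_bound[of "cmod (f x)" "cmod (g x)"] by linarith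
    then show "norm (f x * g x) \<le> norm ((cmod (f x))\<^sup>2 + (cmod (g x))\<^sup>2)"
      by (simp add: norm_mult)
  qed
qed (use assms in measurable)

lemma square_integrable_inner:
  assumes "square_integrable M f" "square_integrable M g"
  shows "integrable M (\<lambda>x. f x \<bullet> g x)"
proof -
  have "square_integrable M (\<lambda>x. cnj (g x))"
    using assms(2) borel_measurable_continuous_on[of cnj, OF continuous_on_cnj[OF continuous_on_id]]
    by (auto simp: square_integrable_def)
  from square_integrable_integrable_mult[OF assms(1) this]
  have "integrable M (\<lambda>x. Re (f x * cnj (g x)))" by (rule integrable_Re)
  then show ?thesis by (simp add: inner_complex_def)
qed

section \<open>The circle and its Hilbert space of square integrable functions\<close>

definition circ :: "complex measure" where
  "circ = distr (restrict_space lborel {0..<2*pi}) (restrict_space borel (sphere 0 1)) cis"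

lemma space_circ [simp]: "space circ = sphere 0 1"
  by (simp add: circ_def space_restrict_space)

lemma sets_circ [simp, measurable_cong]: "sets circ = sets (restrict_space borel (sphere 0 1))"
  by (simp add: circ_def)

lemma cis_borel: "cis \<in> borel_measurable borel"
  by (intro borel_measurable_continuous_onI continuous_intros)

lemma cis_measurable [measurable]:
  "cis \<in> restrict_space lborel {0..<2*pi} \<rightarrow>\<^sub>M restrict_space borel (sphere 0 1)"
  by (rule measurable_restrict_space2, simp, rule measurable_restrict_space1) (simp add: cis_borel)

lemma finite_measure_circ: "finite_measure circ"
  unfolding circ_def
proof (rule finite_measure.finite_measure_distr)
  show "finite_measure (restrict_space lborel {0..<2*pi})"
    by (rule finite_measureI) (simp add: emeasure_restrict_space space_restrict_space)
qed simp

lemma borel_measurable_circI: "f \<in> borel_measurable borel \<Longrightarrow> f \<in> borel_measurable circ"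
  unfolding measurable_cong_sets[OF sets_circ refl] by (rule measurable_restrict_space1)

lemma square_integrable_circ_bounded:
  assumes "f \<in> borel_measurable circ" "\<And>z. cmod z = 1 \<Longrightarrow> cmod (f z) \<le> B"
  shows "square_integrable circ f"
proof (rule square_integrable_bound[where w = "\<lambda>_. B\<^sup>2"])
  interpret finite_measure circ by (rule finite_measure_circ)
  show "integrable circ (\<lambda>_. B\<^sup>2)" by simp
  show "AE x in circ. (cmod (f x))\<^sup>2 \<le> B\<^sup>2"
    by (rule AE_I2) (use assms(2) in \<open>auto intro!: power_mono\<close>)
qed (rule assms)

definition L2rel :: "(complex \<Rightarrow> complex) \<Rightarrow> (complex \<Rightarrow> complex) \<Rightarrow> bool" where
  "L2rel f g \<longleftrightarrow> square_integrable circ f \<and> square_integrable circ g \<and> (AE z in circ. f z = g z)"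

lemma L2rel_refl_iff: "L2rel f f \<longleftrightarrow> square_integrable circ f"
  by (simp add: L2rel_def)

lemma L2rel_I: "square_integrable circ f \<Longrightarrow> (\<And>z. f z = g z) \<Longrightarrow> L2rel f g"
proof -
  assume f: "square_integrable circ f" and "\<And>z. f z = g z"
  then have "f = g" by blast
  with f show "L2rel f g" by (simp add: L2rel_refl_iff)
qed

text \<open>$L^2(\mathbb{T})$: square integrable functions modulo equality almost everywhere.\<close>

quotient_type L2T = "complex \<Rightarrow> complex" / partial: L2rel
proof (rule part_equivpI)
  show "\<exists>f. L2rel f f" by (rule exI[of _ "\<lambda>_. 0"]) (simp add: L2rel_def)
  show "symp L2rel" by (rule sympI) (auto simp: L2rel_def)
  show "transp L2rel" by (rule transpI) (auto simp: L2rel_def)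
qed

instantiation L2T :: real_inner
begin

lift_definition zero_L2T :: L2T is "\<lambda>_. 0" by (simp add: L2rel_def)
lift_definition plus_L2T :: "L2T \<Rightarrow> L2T \<Rightarrow> L2T" is "\<lambda>f g z. f z + g z"
  by (auto simp: L2rel_def intro: square_integrable_add)
lift_definition minus_L2T :: "L2T \<Rightarrow> L2T \<Rightarrow> L2T" is "\<lambda>f g z. f z - g z"
  by (auto simp: L2rel_def intro: square_integrable_diff)
lift_definition uminus_L2T :: "L2T \<Rightarrow> L2T" is "\<lambda>f z. - f z"
  by (auto simp: L2rel_def intro: square_integrable_minus)
lift_definition scaleR_L2T :: "real \<Rightarrow> L2T \<Rightarrow> L2T" is "\<lambda>c f z. c *\<^sub>R f z"
  by (auto simp: L2rel_def intro: square_integrable_scaleR)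
lift_definition inner_L2T :: "L2T \<Rightarrow> L2T \<Rightarrow> real" is "\<lambda>f g. LINT z|circ. f z \<bullet> g z"
proof -
  fix f f' g g' assume "L2rel f f'" "L2rel g g'"
  then show "(LINT z|circ. f z \<bullet> g z) = (LINT z|circ. f' z \<bullet> g' z)"
    unfolding L2rel_def by (intro Bochner_Integration.integral_cong_AE) auto
qed

definition norm_L2T :: "L2T \<Rightarrow> real" where "norm_L2T f = sqrt (f \<bullet> f)"
definition sgn_L2T :: "L2T \<Rightarrow> L2T" where "sgn_L2T f = scaleR (inverse (norm f)) f"
definition dist_L2T :: "L2T \<Rightarrow> L2T \<Rightarrow> real" where "dist_L2T f g = norm (f - g)"
definition uniformity_L2T :: "(L2T \<times> L2T) filter" where
  "uniformity_L2T = (INF e\<in>{0<..}. principal {(x, y). dist x y < e})"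
definition open_L2T :: "L2T set \<Rightarrow> bool" where
  "open_L2T U = (\<forall>x\<in>U. \<forall>\<^sub>F (x', y) in uniformity. x' = x \<longrightarrow> y \<in> U)"

instance
proof
  fix x y z :: L2T and a b :: real
  show "x + y + z = x + (y + z)"
    by transfer (rule L2rel_I, simp add: L2rel_refl_iff square_integrable_add, simp)
  show "x + y = y + x"
    by transfer (rule L2rel_I, simp add: L2rel_refl_iff square_integrable_add, simp)
  show "0 + x = x"
    by transfer (rule L2rel_I, simp add: L2rel_refl_iff , simp)
  show "- x + x = 0"
    by transfer (rule L2rel_I, simp add: L2rel_refl_iff , simp)
  show "x - y = x + - y"
    by transfer (rule L2rel_I, simp add: L2rel_refl_iff square_integrable_diff, simp)
  show "a *\<^sub>R (x + y) = a *\<^sub>R x + a *\<^sub>R y"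
    by transfer (rule L2rel_I, simp add: L2rel_refl_iff square_integrable_add square_integrable_scaleR, simp add: scaleR_add_right)
  show "(a + b) *\<^sub>R x = a *\<^sub>R x + b *\<^sub>R x"
    by transfer (rule L2rel_I, simp add: L2rel_refl_iff square_integrable_scaleR, simp add: scaleR_add_left)
  show "a *\<^sub>R b *\<^sub>R x = (a * b) *\<^sub>R x"
    by transfer (rule L2rel_I, simp add: L2rel_refl_iff square_integrable_scaleR, simp)
  show "1 *\<^sub>R x = x"
    by transfer (rule L2rel_I, simp add: L2rel_refl_iff , simp)
  show "inner x y = inner y x" by transfer (simp only: inner_commute)
  show "inner (x + y) z = inner x z + inner y z"
    by transfer (simp add: L2rel_refl_iff inner_add_left square_integrable_inner)
  show "inner (a *\<^sub>R x) y = a * inner x y"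
    by transfer simp
  show "0 \<le> inner x x" by transfer simp
  show "inner x x = 0 \<longleftrightarrow> x = 0"
  proof transfer
    fix f assume f: "L2rel f f"
    then have "integrable circ (\<lambda>z. f z \<bullet> f z)"
      by (auto simp: L2rel_def square_integrable_inner)
    from integral_nonneg_eq_0_iff_AE[OF this]
    show "(LINT z|circ. f z \<bullet> f z) = 0 \<longleftrightarrow> L2rel f (\<lambda>_. 0)"
      using f by (auto simp: L2rel_def)
  qed
  show "norm x = sqrt (inner x x)" by (rule norm_L2T_def)
  show "sgn x = scaleR (inverse (norm x)) x" by (rule sgn_L2T_def)
  show "dist x y = norm (x - y)" by (rule dist_L2T_def)
  show "uniformity = (INF e\<in>{0<..}. principal {(x, y :: L2T). dist x y < e})"
    by (rule uniformity_L2T_def)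
  show "open U = (\<forall>x\<in>U. \<forall>\<^sub>F (x', y) in uniformity. x' = x \<longrightarrow> y \<in> U)" for U :: "L2T set"
    by (rule open_L2T_def)
qed

end

text \<open>The class of a function; the junk value \<open>0\<close> is used when it is not square integrable.\<close>

definition L2_class :: "(complex \<Rightarrow> complex) \<Rightarrow> L2T" where
  "L2_class f = (if square_integrable circ f then abs_L2T f else 0)"

lemma L2_class_eq_iff:
  assumes "square_integrable circ f" "square_integrable circ g"
  shows "L2_class f = L2_class g \<longleftrightarrow> (AE z in circ. f z = g z)"
  using assms Quotient3_rel[OF Quotient3_L2T, of f g] by (auto simp: L2_class_def L2rel_def)

lemma L2_class_surj: obtains g where "square_integrable circ g" "f = L2_class g"
proof -
  have "L2rel (rep_L2T f) (rep_L2T f)" by (rule Quotient3_rep_reflp[OF Quotient3_L2T])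
  moreover have "abs_L2T (rep_L2T f) = f" by (rule Quotient3_abs_rep[OF Quotient3_L2T])
  ultimately show ?thesis by (intro that[of "rep_L2T f"]) (auto simp: L2_class_def L2rel_def)
qed

lemma L2_class_diff:
  assumes "square_integrable circ f" "square_integrable circ g"
  shows "L2_class f - L2_class g = L2_class (\<lambda>z. f z - g z)"
  using assms by (auto simp: L2_class_def square_integrable_diff minus_L2T.abs_eq L2rel_def)

lemma norm_L2_class:
  assumes "square_integrable circ f"
  shows "norm (L2_class f) = sqrt (LINT z|circ. (cmod (f z))\<^sup>2)"
proof -
  have "L2_class f \<bullet> L2_class f = (LINT z|circ. f z \<bullet> f z)"
    using assms by (simp add: L2_class_def inner_L2T.abs_eq L2rel_refl_iff)
  then show ?thesis
    unfolding norm_L2T_def by (simp only: dot_square_norm)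
qed

lemma norm_L2_class_nn:
  assumes "square_integrable circ f"
  shows "ennreal ((norm (L2_class f))\<^sup>2) = (\<integral>\<^sup>+z. ennreal ((cmod (f z))\<^sup>2) \<partial>circ)"
  using assms
  by (subst nn_integral_eq_integral) (auto simp: norm_L2_class square_integrable_def)


subsection \<open>Completeness\<close>

lemma L2_class_lift:
  fixes X :: "nat \<Rightarrow> L2T"
  obtains F where "\<And>n. square_integrable circ (F n)" "\<And>n. X n = L2_class (F n)"
proof -
  have "\<exists>g. square_integrable circ g \<and> X n = L2_class g" for n
    by (rule L2_class_surj[of "X n"]) blast
  then show ?thesis using that by metis
qed

lemma integral_cmod_le_norm_L2_class:
  assumes f: "square_integrable circ f"
  shows "integrable circ (\<lambda>z. cmod (f z))"
    and "(LINT z|circ. cmod (f z)) \<le> norm (L2_class f) * norm (L2_class (\<lambda>_. 1))"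
proof -
  have 1: "square_integrable circ (\<lambda>_. 1)"
    by (rule square_integrable_circ_bounded[where B = 1]) auto
  have a: "square_integrable circ (\<lambda>z. complex_of_real (cmod (f z)))"
    using f by (auto simp: square_integrable_def)
  from square_integrable_inner[OF a 1] show "integrable circ (\<lambda>z. cmod (f z))"
    by simp
  have "(LINT z|circ. cmod (f z)) = L2_class (\<lambda>z. complex_of_real (cmod (f z))) \<bullet> L2_class (\<lambda>_. 1)"
    using a 1 by (simp add: L2_class_def inner_L2T.abs_eq L2rel_def)
  also have "\<dots> \<le> norm (L2_class (\<lambda>z. complex_of_real (cmod (f z)))) * norm (L2_class (\<lambda>_. 1))"
    using Cauchy_Schwarz_ineq2[of "L2_class (\<lambda>z. complex_of_real (cmod (f z)))" "L2_class (\<lambda>_. 1)"]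
    by linarith
  also have "norm (L2_class (\<lambda>z. complex_of_real (cmod (f z)))) = norm (L2_class f)"
    using a f by (simp add: norm_L2_class)
  finally show "(LINT z|circ. cmod (f z)) \<le> norm (L2_class f) * norm (L2_class (\<lambda>_. 1))" .
qed

lemma L2_fast_AE_convergent:
  assumes F: "\<And>n. square_integrable circ (F n)"
    and s: "summable (\<lambda>n. norm (L2_class (F (Suc n)) - L2_class (F n)))"
  shows "AE z in circ. convergent (\<lambda>n. F n z)"
proof -
  let ?G = "\<lambda>n z. F (Suc n) z - F n z"
  have G: "square_integrable circ (?G n)" for n
    by (intro square_integrable_diff F)
  have [measurable]: "?G n \<in> borel_measurable circ" for n
    using G square_integrable_def by blast
  have le: "(LINT z|circ. cmod (?G n z)) \<le> norm (L2_class (F (Suc n)) - L2_class (F n)) * norm (L2_class (\<lambda>_. 1))" for n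
    using integral_cmod_le_norm_L2_class(2)[OF G] by (simp add: L2_class_diff F)
  have sum1: "summable (\<lambda>n. LINT z|circ. cmod (?G n z))"
    by (rule summable_comparison_test'[OF summable_mult2[OF s]]) (use le in auto)
  have "(\<integral>\<^sup>+z. (\<Sum>n. ennreal (cmod (?G n z))) \<partial>circ) = (\<Sum>n. \<integral>\<^sup>+z. ennreal (cmod (?G n z)) \<partial>circ)"
    by (rule nn_integral_suminf) simp
  also have "\<dots> = (\<Sum>n. ennreal (LINT z|circ. cmod (?G n z)))"
    by (intro arg_cong[where f = suminf] ext nn_integral_eq_integral integral_cmod_le_norm_L2_class G) auto
  also have "\<dots> \<noteq> \<infinity>"
    using sum1 by (simp add: ennreal_suminf_neq_top)
  finally have "AE z in circ. (\<Sum>n. ennreal (cmod (?G n z))) \<noteq> \<infinity>"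
    by (intro nn_integral_noteq_infinite) auto
  then show ?thesis
  proof (rule AE_mp, intro AE_I2 impI)
    fix z assume "(\<Sum>n. ennreal (cmod (?G n z))) \<noteq> \<infinity>"
    then have "summable (\<lambda>n. cmod (?G n z))"
      by (intro summable_suminf_not_top) auto
    then have "summable (\<lambda>n. ?G n z)" by (rule summable_norm_cancel)
    then have "convergent (\<lambda>n. \<Sum>i<n. ?G i z)" by (simp add: summable_iff_convergent)
    then have "convergent (\<lambda>n. F n z - F 0 z)" by (simp only: sum_lessThan_telescope[where f = "\<lambda>n. F n z"])
    then have "convergent (\<lambda>n. F n z - F 0 z + F 0 z)"
      by (intro convergent_add convergent_const)
    then show "convergent (\<lambda>n. F n z)" by simp
  qed
qed

lemma L2_Fatou:
  assumes F: "\<And>n. square_integrable circ (F n)" and f: "f \<in> borel_measurable circ"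
    and lim: "AE z in circ. (\<lambda>n. F n z) \<longlonglongrightarrow> f z" and "e \<ge> 0"
    and e: "\<And>n. n \<ge> m \<Longrightarrow> norm (L2_class (F m) - L2_class (F n)) \<le> e"
  shows "square_integrable circ f" "norm (L2_class (F m) - L2_class f) \<le> e"
proof -
  have [measurable]: "F n \<in> borel_measurable circ" for n
    using F square_integrable_def by blast
  note [measurable] = f
  have "(\<integral>\<^sup>+z. ennreal ((cmod (F m z - f z))\<^sup>2) \<partial>circ) =
      (\<integral>\<^sup>+z. liminf (\<lambda>n. ennreal ((cmod (F m z - F n z))\<^sup>2)) \<partial>circ)"
  proof (rule nn_integral_cong_AE, rule AE_mp[OF lim], intro AE_I2 impI)
    fix z assume "(\<lambda>n. F n z) \<longlonglongrightarrow> f z"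
    then have "(\<lambda>n. ennreal ((cmod (F m z - F n z))\<^sup>2)) \<longlonglongrightarrow> ennreal ((cmod (F m z - f z))\<^sup>2)"
      by (intro tendsto_ennrealI tendsto_intros)
    then show "ennreal ((cmod (F m z - f z))\<^sup>2) = liminf (\<lambda>n. ennreal ((cmod (F m z - F n z))\<^sup>2))"
      by (intro lim_imp_Liminf[symmetric] trivial_limit_sequentially)
  qed
  also have "\<dots> \<le> liminf (\<lambda>n. \<integral>\<^sup>+z. ennreal ((cmod (F m z - F n z))\<^sup>2) \<partial>circ)"
    by (rule nn_integral_liminf) simp
  also have "\<dots> \<le> liminf (\<lambda>n. ennreal (e\<^sup>2))"
  proof (rule Liminf_mono, rule eventually_sequentiallyI[of m])
    fix n assume "m \<le> n"
    have "(\<integral>\<^sup>+z. ennreal ((cmod (F m z - F n z))\<^sup>2) \<partial>circ) = ennreal ((norm (L2_class (F m) - L2_class (F n)))\<^sup>2)"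
      by (simp add: L2_class_diff F norm_L2_class_nn square_integrable_diff)
    also have "\<dots> \<le> ennreal (e\<^sup>2)"
      by (intro ennreal_leI power_mono e \<open>m \<le> n\<close>) auto
    finally show "(\<integral>\<^sup>+z. ennreal ((cmod (F m z - F n z))\<^sup>2) \<partial>circ) \<le> ennreal (e\<^sup>2)" .
  qed
  finally have le: "(\<integral>\<^sup>+z. ennreal ((cmod (F m z - f z))\<^sup>2) \<partial>circ) \<le> ennreal (e\<^sup>2)"
    by (simp add: Liminf_const)
  have d: "square_integrable circ (\<lambda>z. F m z - f z)"
    unfolding square_integrable_def
    by (intro conjI integrableI_bounded) (use le in \<open>auto intro: le_less_trans\<close>)
  from square_integrable_diff[OF F[of m] this] show sf: "square_integrable circ f" by simp
  have "ennreal ((norm (L2_class (F m) - L2_class f))\<^sup>2) \<le> ennreal (e\<^sup>2)"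
    using le d by (simp add: L2_class_diff F sf norm_L2_class_nn)
  then have "(norm (L2_class (F m) - L2_class f))\<^sup>2 \<le> e\<^sup>2" by simp
  then show "norm (L2_class (F m) - L2_class f) \<le> e"
    using \<open>e \<ge> 0\<close> by (rule power2_le_imp_le)
qed

instance L2T :: banach
proof
  fix X :: "nat \<Rightarrow> L2T"
  assume X: "Cauchy X"
  have "\<exists>N. \<forall>m\<ge>N. \<forall>n\<ge>N. dist (X m) (X n) < (1/2)^k" for k :: nat
    using X unfolding Cauchy_def by simp
  then obtain N where N: "\<And>k m n. m \<ge> N k \<Longrightarrow> n \<ge> N k \<Longrightarrow> dist (X m) (X n) < (1/2)^k"
    by metis
  define r where "r k = Max (N ` {..k})" for k
  have r: "N k \<le> r n" if "k \<le> n" for k n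
    using that by (auto simp: r_def)
  obtain F where F: "\<And>n. square_integrable circ (F n)" and XF: "\<And>n. X (r n) = L2_class (F n)"
    by (rule L2_class_lift[of "\<lambda>n. X (r n)"]) blast
  have [measurable]: "F n \<in> borel_measurable circ" for n
    using F square_integrable_def by blast
  have d: "norm (L2_class (F m) - L2_class (F n)) \<le> (1/2)^m" if "m \<le> n" for m n
    using N[OF r[OF order_refl] r[OF that]] by (simp add: XF dist_norm)
  have "summable (\<lambda>n. norm (L2_class (F (Suc n)) - L2_class (F n)))"
    by (rule summable_comparison_test'[where g = "\<lambda>n. (1/2)^n" and N = 0])
      (use d[of _ "Suc _"] in \<open>auto simp: norm_minus_commute summable_geometric\<close>)
  from L2_fast_AE_convergent[OF F this]
  have lim: "AE z in circ. (\<lambda>n. F n z) \<longlonglongrightarrow> lim (\<lambda>n. F n z)"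
    by (simp add: convergent_LIMSEQ_iff)
  have "norm (X (r m) - L2_class (\<lambda>z. lim (\<lambda>n. F n z))) \<le> (1/2)^m" for m
    unfolding XF by (rule L2_Fatou(2)[OF F _ lim]) (use d in auto)
  then have le: "dist (X n) (L2_class (\<lambda>z. lim (\<lambda>n. F n z))) \<le> 2 * (1/2)^m" if "n \<ge> r m" for n m
  proof -
    have "dist (X n) (X (r m)) < (1/2)^m"
      using N[of m n "r m"] r[of m m] that by simp
    moreover have "dist (X (r m)) (L2_class (\<lambda>z. lim (\<lambda>n. F n z))) \<le> (1/2)^m"
      using \<open>norm (X (r m) - L2_class (\<lambda>z. lim (\<lambda>n. F n z))) \<le> (1/2)^m\<close> by (simp add: dist_norm)
    ultimately show ?thesis
      using dist_triangle[of "X n" "L2_class (\<lambda>z. lim (\<lambda>n. F n z))" "X (r m)"] by linarith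
  qed
  have "X \<longlonglongrightarrow> L2_class (\<lambda>z. lim (\<lambda>n. F n z))"
  proof (rule LIMSEQ_I)
    fix e :: real assume "e > 0"
    then obtain m where m: "(1/2)^m < e / 2"
      using real_arch_pow_inv[of "e/2" "1/2"] by auto
    have "norm (X n - L2_class (\<lambda>z. lim (\<lambda>n. F n z))) < e" if "n \<ge> r m" for n
      using le[OF that] m unfolding dist_norm by linarith
    then show "\<exists>n0. \<forall>n\<ge>n0. norm (X n - L2_class (\<lambda>z. lim (\<lambda>n. F n z))) < e"
      by blast
  qed
  then show "convergent X" by (rule convergentI)
qed


subsection \<open>Separability\<close>

lemma L2_class_dominated:
  assumes F: "\<And>n. F n \<in> borel_measurable circ" and f: "f \<in> borel_measurable circ"
    and lim: "AE z in circ. (\<lambda>n. F n z) \<longlonglongrightarrow> f z"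
    and w: "integrable circ w"
    and le: "\<And>n z. cmod z = 1 \<Longrightarrow> (cmod (F n z))\<^sup>2 \<le> w z"
    and lef: "\<And>z. cmod z = 1 \<Longrightarrow> (cmod (f z))\<^sup>2 \<le> w z"
  shows "(\<lambda>n. L2_class (F n)) \<longlonglongrightarrow> L2_class f"
proof -
  note [measurable] = F f
  have sF: "square_integrable circ (F n)" for n
    by (rule square_integrable_bound[OF F w AE_I2]) (simp add: le)
  have sf: "square_integrable circ f"
    by (rule square_integrable_bound[OF f w AE_I2]) (simp add: lef)
  have "(\<lambda>n. LINT z|circ. (cmod (F n z - f z))\<^sup>2) \<longlonglongrightarrow> (LINT z|circ. 0)"
  proof (rule integral_dominated_convergence[where w = "\<lambda>z. 4 * w z"])
    show "AE z in circ. (\<lambda>n. (cmod (F n z - f z))\<^sup>2) \<longlonglongrightarrow> 0"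
    proof (rule AE_mp[OF lim], intro AE_I2 impI)
      fix z assume "(\<lambda>n. F n z) \<longlonglongrightarrow> f z"
      then have "(\<lambda>n. (cmod (F n z - f z))\<^sup>2) \<longlonglongrightarrow> (cmod (f z - f z))\<^sup>2"
        by (intro tendsto_intros)
      then show "(\<lambda>n. (cmod (F n z - f z))\<^sup>2) \<longlonglongrightarrow> 0" by simp
    qed
    show "AE z in circ. norm ((cmod (F n z - f z))\<^sup>2) \<le> 4 * w z" for n
    proof (rule AE_I2)
      fix z assume "z \<in> space circ"
      then have z: "cmod z = 1" by simp
      show "norm ((cmod (F n z - f z))\<^sup>2) \<le> 4 * w z"
        using cmod_add_sq[of "F n z" "- f z"] le[OF z, of n] lef[OF z] by simp
    qed
  qed (use w in auto)
  then have "(\<lambda>n. sqrt (LINT z|circ. (cmod (F n z - f z))\<^sup>2)) \<longlonglongrightarrow> sqrt 0"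
    by (intro tendsto_real_sqrt) simp
  then have "(\<lambda>n. norm (L2_class (F n) - L2_class f)) \<longlonglongrightarrow> 0"
    by (simp add: L2_class_diff norm_L2_class sF sf square_integrable_diff)
  then show ?thesis
    by (simp add: tendsto_norm_zero_iff flip: Lim_null)
qed

lemma Arg2pi_cis: "0 \<le> x \<Longrightarrow> x < 2*pi \<Longrightarrow> Arg2pi (cis x) = x"
  using Arg2pi_unique[of 1 x "cis x"] by (simp add: cis_conv_exp)

lemma cis_Arg2pi: "cmod z = 1 \<Longrightarrow> cis (Arg2pi z) = z"
  using complex_norm_eq_1_exp[of z] by (simp add: cis_conv_exp)

lemma Arg2pi_borel [measurable]: "Arg2pi \<in> borel_measurable borel"
  by (rule borel_measurableI_greater) (simp add: borel_open open_Arg2pi2pi_gt)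

lemma Arg2pi_measurable_circ: "Arg2pi \<in> borel_measurable circ"
  unfolding measurable_cong_sets[OF sets_circ refl]
  by (rule measurable_restrict_space1) (rule Arg2pi_borel)

lemma AE_circ_Arg2pi:
  assumes "N \<in> null_sets lborel"
  shows "AE z in circ. Arg2pi z \<notin> N"
proof -
  note [measurable] = Arg2pi_measurable_circ
  have [measurable]: "N \<in> sets borel" using assms by auto
  have m: "{z \<in> space (restrict_space borel (sphere 0 1)). Arg2pi z \<notin> N} \<in> sets (restrict_space borel (sphere 0 1))"
  proof -
    have "{z \<in> space circ. Arg2pi z \<notin> N} \<in> sets circ" by measurable
    then show ?thesis by (simp add: space_restrict_space)
  qed
  have "AE x in lborel. x \<in> {0..<2*pi} \<longrightarrow> Arg2pi (cis x) \<notin> N"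
    by (rule AE_mp[OF AE_not_in[OF assms]]) (auto simp: Arg2pi_cis)
  then have "AE x in restrict_space lborel {0..<2*pi}. Arg2pi (cis x) \<notin> N"
    by (subst AE_restrict_space_iff) auto
  then show ?thesis
    unfolding circ_def by (subst AE_distr_iff[OF cis_measurable m])
qed

definition step_fun :: "complex list \<Rightarrow> complex \<Rightarrow> complex" where
  "step_fun qs z = (\<Sum>k<length qs. if Arg2pi z \<in> {2*pi*k/length qs..<2*pi*(k+1)/length qs} then qs ! k else 0)"

lemma step_fun_measurable: "step_fun qs \<in> borel_measurable circ"
proof -
  note [measurable] = Arg2pi_measurable_circ
  show ?thesis unfolding step_fun_def by measurable
qed

lemma step_fun_eq:
  assumes "qs \<noteq> []"
  defines "k z \<equiv> nat \<lfloor>length qs * Arg2pi z / (2*pi)\<rfloor>"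
  shows "k z < length qs" "step_fun qs z = qs ! k z" "\<bar>2*pi*k z/length qs - Arg2pi z\<bar> \<le> 2*pi/length qs"
proof -
  let ?N = "real (length qs)"
  have N: "?N > 0" using assms by simp
  have A: "0 \<le> Arg2pi z" "Arg2pi z < 2*pi" using Arg2pi[of z] by auto
  have "?N * Arg2pi z / (2*pi) < ?N" using A N by (simp add: divide_less_eq)
  moreover have 0: "0 \<le> ?N * Arg2pi z / (2*pi)" using A N by simp
  ultimately show k: "k z < length qs" unfolding k_def by linarith
  have fl: "real (k z) \<le> ?N * Arg2pi z / (2*pi)" "?N * Arg2pi z / (2*pi) < real (k z) + 1"
    using 0 unfolding k_def by linarith+
  have iff: "Arg2pi z \<in> {2*pi*j/?N..<2*pi*(j+1)/?N} \<longleftrightarrow> real j \<le> ?N * Arg2pi z / (2*pi) \<and> ?N * Arg2pi z / (2*pi) < real j + 1" for j :: nat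
    using N by (simp add: field_simps)
  have iff2: "Arg2pi z \<in> {2*pi*j/?N..<2*pi*(j+1)/?N} \<longleftrightarrow> j = k z" for j :: nat
    unfolding iff using fl by linarith
  have "step_fun qs z = (\<Sum>j<length qs. if j = k z then qs ! j else 0)"
    unfolding step_fun_def by (intro sum.cong refl if_cong) (use iff2 in auto)
  also have "\<dots> = qs ! k z" using k by simp
  finally show "step_fun qs z = qs ! k z" .
  have "Arg2pi z \<in> {2*pi*k z/?N..<2*pi*(k z+1)/?N}" using iff2 by simp
  then show "\<bar>2*pi*k z/length qs - Arg2pi z\<bar> \<le> 2*pi/length qs"
    by (simp add: distrib_left add_divide_distrib)
qed

definition rat_complex :: "rat \<times> rat \<Rightarrow> complex" where
  "rat_complex p = Complex (of_rat (fst p)) (of_rat (snd p))"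

lemma rat_complex_dense: "e > 0 \<Longrightarrow> \<exists>p. cmod (rat_complex p - z) < e"
proof -
  assume "e > 0"
  obtain p where p: "Re z < of_rat p" "of_rat p < Re z + e/2"
    using of_rat_dense[of "Re z" "Re z + e/2"] \<open>e > 0\<close> by auto
  obtain q where q: "Im z < of_rat q" "of_rat q < Im z + e/2"
    using of_rat_dense[of "Im z" "Im z + e/2"] \<open>e > 0\<close> by auto
  have "cmod (rat_complex (p, q) - z) \<le> \<bar>of_rat p - Re z\<bar> + \<bar>of_rat q - Im z\<bar>"
    using cmod_le[of "rat_complex (p, q) - z"] by (simp add: rat_complex_def)
  also have "\<dots> < e" using p q by simp
  finally show ?thesis by blast
qed

definition step_classes :: "L2T set" where
  "step_classes = range (\<lambda>qs. L2_class (step_fun (map rat_complex qs)))"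

lemma countable_step_classes: "countable step_classes"
  unfolding step_classes_def by (rule countable_image) simp

lemma closure_step_classes_continuous:
  assumes g: "continuous_on UNIV (g :: real \<Rightarrow> complex)"
  shows "L2_class (\<lambda>z. g (Arg2pi z)) \<in> closure step_classes"
proof -
  have "bounded (g ` {0..2*pi})"
    by (intro compact_imp_bounded compact_continuous_image continuous_on_subset[OF g]) auto
  then obtain B where B: "\<And>x. x \<in> {0..2*pi} \<Longrightarrow> cmod (g x) \<le> B"
    unfolding bounded_iff by blast
  have A: "Arg2pi z \<in> {0..2*pi}" for z
    using Arg2pi[of z] by auto
  have ex: "\<exists>p. cmod (rat_complex p - g (2*pi*k/Suc n)) < 1 / Suc n" for n k :: nat
    by (rule rat_complex_dense) simp
  define p where "p n k = (SOME p. cmod (rat_complex p - g (2*pi*k/Suc n)) < 1 / Suc n)" for n k :: nat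
  have p: "cmod (rat_complex (p n k) - g (2*pi*k/Suc n)) < 1 / Suc n" for n k :: nat
    unfolding p_def by (rule someI_ex[OF ex])
  define qs where "qs n = map (p n) [0..<Suc n]" for n
  define k where "k n z = nat \<lfloor>Suc n * Arg2pi z / (2*pi)\<rfloor>" for n z
  define F where "F n = step_fun (map rat_complex (qs n))" for n
  have k: "k n z < Suc n" "F n z = rat_complex (p n (k n z))" "\<bar>2*pi*k n z/Suc n - Arg2pi z\<bar> \<le> 2*pi/Suc n" for n z
  proof -
    have ne: "map rat_complex (qs n) \<noteq> []" and len: "length (map rat_complex (qs n)) = Suc n"
      by (auto simp: qs_def)
    note step_fun_eq[OF ne, of z, unfolded len, folded k_def F_def]
    then show "k n z < Suc n" "F n z = rat_complex (p n (k n z))" "\<bar>2*pi*k n z/Suc n - Arg2pi z\<bar> \<le> 2*pi/Suc n"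
      by (auto simp: qs_def simp del: upt_Suc)
  qed
  have lim: "(\<lambda>n. F n z) \<longlonglongrightarrow> g (Arg2pi z)" for z
  proof -
    have 0: "(\<lambda>n. c / Suc n) \<longlonglongrightarrow> 0" for c :: real
      using tendsto_mult_right_zero[OF LIMSEQ_inverse_real_of_nat, of c] by (simp add: divide_inverse)
    have "(\<lambda>n. 2*pi*k n z/Suc n - Arg2pi z) \<longlonglongrightarrow> 0"
      by (rule Lim_null_comparison[OF _ 0[of "2*pi"]]) (use k(3) in auto)
    then have "(\<lambda>n. 2*pi*k n z/Suc n) \<longlonglongrightarrow> Arg2pi z" by (simp add: Lim_null[symmetric])
    moreover have "isCont g (Arg2pi z)" using g by (simp add: continuous_on_eq_continuous_at)
    ultimately have 1: "(\<lambda>n. g (2*pi*k n z/Suc n)) \<longlonglongrightarrow> g (Arg2pi z)"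
      by (rule isCont_tendsto_compose[rotated])
    have "(\<lambda>n. F n z - g (2*pi*k n z/Suc n)) \<longlonglongrightarrow> 0"
      by (rule Lim_null_comparison[OF _ 0[of 1]]) (use p k(2) in \<open>auto intro!: always_eventually less_imp_le\<close>)
    from tendsto_add[OF this 1] show ?thesis by simp
  qed
  have bd: "cmod (F n z) \<le> B + 1" for n z
  proof -
    have "2*pi*k n z/Suc n \<in> {0..2*pi}"
      using k(1)[of n z] by (auto simp: divide_le_eq)
    from B[OF this] have "cmod (g (2*pi*k n z/Suc n)) \<le> B" .
    moreover have "cmod (F n z) \<le> cmod (F n z - g (2*pi*k n z/Suc n)) + cmod (g (2*pi*k n z/Suc n))"
      by (metis norm_triangle_ineq diff_add_cancel)
    moreover have "cmod (F n z - g (2*pi*k n z/Suc n)) < 1 / Suc n" using p k(2) by simp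
    moreover have "1 / real (Suc n) \<le> 1" by simp
    ultimately show ?thesis by linarith
  qed
  have gb: "cmod (g (Arg2pi z)) \<le> B + 1" for z
    using B[OF A[of z]] by simp
  have "(\<lambda>n. L2_class (F n)) \<longlonglongrightarrow> L2_class (\<lambda>z. g (Arg2pi z))"
  proof (rule L2_class_dominated[where w = "\<lambda>_. (B + 1)\<^sup>2"])
    interpret finite_measure circ by (rule finite_measure_circ)
    show "F n \<in> borel_measurable circ" for n unfolding F_def by (rule step_fun_measurable)
    show "(\<lambda>z. g (Arg2pi z)) \<in> borel_measurable circ"
      by (rule measurable_compose[OF Arg2pi_measurable_circ borel_measurable_continuous_onI[OF g]])
    show "integrable circ (\<lambda>_. (B + 1)\<^sup>2)" by simp
  qed (use bd gb lim in \<open>auto intro!: power_mono\<close>)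
  moreover have "L2_class (F n) \<in> step_classes" for n
    unfolding F_def step_classes_def by blast
  ultimately show ?thesis
    unfolding closure_sequential by (intro exI[of _ "\<lambda>n. L2_class (F n)"] conjI allI)
qed

lemma closure_step_classes_bounded:
  assumes f: "f \<in> borel_measurable circ" and b: "\<And>z. cmod z = 1 \<Longrightarrow> cmod (f z) \<le> b" and "b > 0"
  shows "L2_class f \<in> closure step_classes"
proof -
  define h where "h x = (if x \<in> {0..<2*pi} then f (cis x) else 0)" for x
  have "(\<lambda>x. f (cis x)) \<in> borel_measurable (restrict_space lborel {0..<2*pi})"
    using measurable_compose[OF cis_measurable, of f borel] f
    unfolding measurable_cong_sets[OF sets_circ refl] .
  then have "h \<in> borel_measurable lborel"
    unfolding h_def by (subst (asm) measurable_restrict_space_iff[where c = 0]) auto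
  then have "h \<in> borel_measurable lebesgue"
    by (simp add: measurable_completion)
  then have "h measurable_on UNIV"
    by (intro lebesgue_measurable_imp_measurable_on) auto
  then obtain N g where N: "negligible N" and g: "\<And>n :: nat. continuous_on UNIV (g n)"
    and lim: "\<And>x. x \<notin> N \<Longrightarrow> (\<lambda>n. g n x) \<longlonglongrightarrow> h x"
    unfolding measurable_on_def by auto
  obtain N' where N': "N' \<in> null_sets lborel" "N \<subseteq> N'"
    using N unfolding negligible_iff_null_sets null_sets_completion_iff2 by blast
  define cl where "cl w = of_real (b / max b (cmod w)) * w" for w :: complex
  have cl_cont: "continuous_on UNIV cl"
    unfolding cl_def using \<open>b > 0\<close> by (intro continuous_intros) auto
  have cl_id: "cl w = w" if "cmod w \<le> b" for w
    using that \<open>b > 0\<close> by (simp add: cl_def max_def)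
  have cl_le: "cmod (cl w) \<le> b" for w
    using \<open>b > 0\<close> by (auto simp: cl_def max_def norm_mult norm_divide field_simps)
  have cg: "continuous_on UNIV (\<lambda>x. cl (g n x))" for n
    by (rule continuous_on_compose2[OF cl_cont g]) auto
  have "(\<lambda>n. L2_class (\<lambda>z. cl (g n (Arg2pi z)))) \<longlonglongrightarrow> L2_class f"
  proof (rule L2_class_dominated[where w = "\<lambda>_. b\<^sup>2"])
    interpret finite_measure circ by (rule finite_measure_circ)
    show "(\<lambda>z. cl (g n (Arg2pi z))) \<in> borel_measurable circ" for n
      by (rule measurable_compose[OF Arg2pi_measurable_circ borel_measurable_continuous_onI[OF cg]])
    show "integrable circ (\<lambda>_. b\<^sup>2)" by simp
    show "AE z in circ. (\<lambda>n. cl (g n (Arg2pi z))) \<longlonglongrightarrow> f z"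
    proof (rule AE_mp[OF AE_circ_Arg2pi[OF N'(1)]], intro AE_I2 impI)
      fix z assume z: "z \<in> space circ" "Arg2pi z \<notin> N'"
      then have cz: "cmod z = 1" by simp
      have "h (Arg2pi z) = f z"
        using Arg2pi[of z] cis_Arg2pi[OF cz] by (simp add: h_def)
      moreover have "(\<lambda>n. g n (Arg2pi z)) \<longlonglongrightarrow> h (Arg2pi z)" using z N'(2) lim by blast
      ultimately have l: "(\<lambda>n. g n (Arg2pi z)) \<longlonglongrightarrow> f z" by simp
      have "isCont cl (f z)" using cl_cont by (simp add: continuous_on_eq_continuous_at)
      from isCont_tendsto_compose[OF this l] show "(\<lambda>n. cl (g n (Arg2pi z))) \<longlonglongrightarrow> f z"
        using cl_id[OF b[OF cz]] by simp
    qed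
  qed (use f cl_le b \<open>b > 0\<close> in \<open>auto intro!: power_mono\<close>)
  then have "L2_class f \<in> closure (closure step_classes)"
    unfolding closure_sequential[of _ "closure step_classes"]
    using closure_step_classes_continuous[OF cg]
    by (intro exI[of _ "\<lambda>n. L2_class (\<lambda>z. cl (g n (Arg2pi z)))"] conjI allI)
  then show ?thesis by simp
qed

lemma closure_step_classes: "closure step_classes = UNIV"
proof -
  have "x \<in> closure step_classes" for x
  proof -
    obtain f where f: "square_integrable circ f" and x: "x = L2_class f"
      by (rule L2_class_surj)
    have [measurable]: "f \<in> borel_measurable circ" using f by (simp add: square_integrable_def)
    define F where "F n z = (if cmod (f z) \<le> Suc n then f z else 0)" for n z
    have [measurable]: "F n \<in> borel_measurable circ" for n
      unfolding F_def by measurable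
    have "(\<lambda>n. L2_class (F n)) \<longlonglongrightarrow> L2_class f"
    proof (rule L2_class_dominated[where w = "\<lambda>z. (cmod (f z))\<^sup>2"])
      show "integrable circ (\<lambda>z. (cmod (f z))\<^sup>2)" using f by (simp add: square_integrable_def)
      show "AE z in circ. (\<lambda>n. F n z) \<longlonglongrightarrow> f z"
      proof (rule AE_I2, rule tendsto_eventually)
        fix z
        obtain n0 :: nat where "cmod (f z) \<le> n0" using real_arch_simple by blast
        then show "\<forall>\<^sub>F n in sequentially. F n z = f z"
          by (intro eventually_sequentiallyI[of n0]) (auto simp: F_def)
      qed
      show "(cmod (F n z))\<^sup>2 \<le> (cmod (f z))\<^sup>2" for n z
        by (simp add: F_def)
    qed auto
    moreover have "L2_class (F n) \<in> closure step_classes" for n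
      by (rule closure_step_classes_bounded[where b = "Suc n"]) (auto simp: F_def)
    ultimately have "L2_class f \<in> closure (closure step_classes)"
      unfolding closure_sequential[of _ "closure step_classes"]
      by (intro exI[of _ "\<lambda>n. L2_class (F n)"] conjI allI)
    then show ?thesis by (simp add: x)
  qed
  then show ?thesis by blast
qed

instance L2T :: second_countable_topology
proof
  define B where "B = (\<lambda>(x :: L2T, q). ball x (of_rat q)) ` (step_classes \<times> UNIV)"
  have "countable B"
    unfolding B_def by (intro countable_image countable_SIGMA countable_step_classes) auto
  moreover have "topological_basis B"
  proof (rule topological_basisI)
    fix U :: "L2T set" and x assume "open U" "x \<in> U"
    then obtain e where e: "e > 0" "ball x e \<subseteq> U" by (auto simp: open_contains_ball)
    obtain q where q: "0 < real_of_rat q" "real_of_rat q < e/2"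
      using of_rat_dense[of 0 "e/2"] e by auto
    have "x \<in> closure step_classes" by (simp add: closure_step_classes)
    then obtain y where y: "y \<in> step_classes" "dist y x < of_rat q"
      using q unfolding closure_approachable by blast
    have "ball y (of_rat q) \<subseteq> ball x e"
    proof
      fix z assume "z \<in> ball y (of_rat q)"
      then show "z \<in> ball x e"
        using y q dist_triangle[of x z y] by (simp add: dist_commute)
    qed
    then show "\<exists>B'\<in>B. x \<in> B' \<and> B' \<subseteq> U"
      using y q e unfolding B_def by (intro bexI[of _ "ball y (of_rat q)"]) force+
  qed (auto simp: B_def)
  ultimately show "\<exists>B :: L2T set set. countable B \<and> open = generate_topology B"
    using topological_basis_imp_subbasis by blast
qed

section \<open>Fourier series, Riesz projector and semigroup\<close>

lift_definition cscale :: "complex \<Rightarrow> L2T \<Rightarrow> L2T" is "\<lambda>c f z. c * f z"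
  by (auto simp: L2rel_def intro: square_integrable_cmult)

lift_definition fourier_coeff :: "L2T \<Rightarrow> int \<Rightarrow> complex"
  is "\<lambda>f n. (LINT z|circ. f z * cnj (z powi n)) / of_real (2*pi)"
proof -
  fix f g assume fg: "L2rel f g"
  have "(LINT z|circ. f z * cnj (z powi n)) = (LINT z|circ. g z * cnj (z powi n))" for n
  proof (rule Bochner_Integration.integral_cong_AE)
    have [measurable]: "f \<in> borel_measurable circ" "g \<in> borel_measurable circ"
      using fg by (auto simp: L2rel_def square_integrable_def)
    have "(\<lambda>z::complex. cnj (z powi n)) \<in> borel_measurable (restrict_space borel (sphere 0 1))"
      by (intro borel_measurable_continuous_on_restrict continuous_intros) auto
    then have [measurable]: "(\<lambda>z. cnj (z powi n)) \<in> borel_measurable circ"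
      unfolding measurable_cong_sets[OF sets_circ refl] .
    show "(\<lambda>z. f z * cnj (z powi n)) \<in> borel_measurable circ"
      "(\<lambda>z. g z * cnj (z powi n)) \<in> borel_measurable circ"
      by measurable
    show "AE z in circ. f z * cnj (z powi n) = g z * cnj (z powi n)"
      using fg by (auto simp: L2rel_def)
  qed
  then show "(\<lambda>n. (LINT z|circ. f z * cnj (z powi n)) / of_real (2*pi)) =
      (\<lambda>n. (LINT z|circ. g z * cnj (z powi n)) / of_real (2*pi))"
    by simp
qed

definition fourier_char :: "int \<Rightarrow> L2T" where
  "fourier_char n = L2_class (\<lambda>z. z powi n)"

text \<open>
  The sums below are unconditionally convergent in the norm of $L^2(\mathbb{T})$; by Bessel's
  inequality they do converge for every \<open>f\<close> (and every \<open>t \<ge> 0\<close>), so the default value of the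
  infinite sum is never used.
\<close>

definition riesz_proj :: "L2T \<Rightarrow> L2T" where
  "riesz_proj f = (\<Sum>\<^sub>\<infinity>n\<in>{0..}. cscale (fourier_coeff f n) (fourier_char n))"

definition H2 :: "L2T set" where
  "H2 = range riesz_proj"

definition semigroup_S :: "real \<Rightarrow> L2T \<Rightarrow> L2T" where
  "semigroup_S t f =
     (\<Sum>\<^sub>\<infinity>n. cscale (fourier_coeff f n * of_real (exp (- \<bar>real_of_int n\<bar> * t))) (fourier_char n))"

section \<open>The control system\<close>

definition open_strict_interval :: "complex set \<Rightarrow> bool" where
  "open_strict_interval \<omega> \<longleftrightarrow> (\<exists>a b. 0 < b - a \<and> b - a < 2*pi \<and> \<omega> = cis ` {a<..<b})"

definition is_control :: "complex set \<Rightarrow> real \<Rightarrow> (real \<times> complex \<Rightarrow> complex) \<Rightarrow> bool" where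
  "is_control \<omega> T u \<longleftrightarrow>
     square_integrable (restrict_space lborel {0..T} \<Otimes>\<^sub>M restrict_space circ \<omega>) u"

text \<open>
  Here $\mathbf{1}_\omega u(s,\cdot)$ is square integrable for almost every $s$, so the default value
  of \<^const>\<open>L2_class\<close> only concerns a null set of times.  The integral is a Bochner integral
  in $L^2(\mathbb{T})$.
\<close>

definition H2_solution :: "complex set \<Rightarrow> (real \<times> complex \<Rightarrow> complex) \<Rightarrow> L2T \<Rightarrow> real \<Rightarrow> L2T" where
  "H2_solution \<omega> u f\<^sub>0 t = semigroup_S t f\<^sub>0 +
     (LINT s:{0..t}|lborel. semigroup_S (t - s) (riesz_proj (L2_class (\<lambda>z. if z \<in> \<omega> then u (s, z) else 0))))"

definition NC_H2 :: "complex set \<Rightarrow> real \<Rightarrow> L2T set" where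
  "NC_H2 \<omega> T = {f\<^sub>0 \<in> H2. \<exists>u. is_control \<omega> T u \<and> H2_solution \<omega> u f\<^sub>0 T = 0}"

end

theory Submission
  imports Defs "HOL-Complex_Analysis.Conformal_Mappings"
begin

text \<open>
  Write $\zeta = e^{-s} z$ for $s \ge 0$, $|z| = 1$.  Reading off Fourier coefficients, a control $u$ on
  $[0,T'] \times \omega$ steers $f_0$ to $0$ at time $T'$ iff
  $2\pi \widehat{f_0}(n) + \int u\, \zeta^{-n} = 0$ for all $n \ge 0$.  For $|\zeta| < e^{-T'}$ this says that
  $$G(\zeta) = f_0(\zeta) + \frac{1}{2\pi} \int \frac{u(s',z')}{1 - \zeta/\zeta'}\, ds'\, dz'$$
  vanishes.  $G$ is holomorphic in the unit disk off the compact set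
  $K = \{e^{-s} z : 0 \le s \le T', z \in \overline{\omega}\}$, and the disk minus $K$ is star-shaped about $0$;
  so $G = 0$ there.  Since $G$ solves the inhomogeneous Cauchy-Riemann equation with source $u$, multiplying by a
  cutoff $\chi(s)$ that is $1$ for $s \le T/2$ and $0$ for $s \ge T$ shows that $\chi u + \chi' G$ is again
  supported in $\overline{\omega}$ and has the same moments as $u$: it steers $f_0$ to $0$ at time $T$.
  It is square integrable because the Cauchy kernel has an integrable singularity.
\<close>

section \<open>Fourier series\<close>

text \<open>The Cauchy-Riemann equation is used only in weak form, as a jump: integrating
  \<open>inv_point (s, z) ^ n\<close> against the kernel over the circle at depth \<open>s\<close>
  gives \<open>2*pi * inv_point y ^ n\<close> for a source \<open>y\<close> with
  \<open>fst y < s\<close>, and 0 if \<open>fst y > s\<close>. For a piecewise linear chi, chi'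
  equals \<open>- 2 / T\<close> on \<open>{T/2..T}\<close>, and integrating the jump over that strip
  reproduces chi. Hence the integral term of chi' G cancels the moments of chi u exactly, while the
  power series term leaves the moments that \<open>f0\<close> prescribes. No smoothness of chi is
  needed. The ramp starts at \<open>T/2\<close> rather than at 0 because \<open>f0\<close> is merely
  square integrable on the circle: its power series may blow up as |zeta| tends to 1, but it is
  bounded for |zeta| at most e^(-T/2). The obstacle is square integrability of G near the sources.
  The squared kernel has circle means of size \<open>1 / \<bar>s - s'\<bar>\<close>, which just
  fails to be integrable, so a plain Cauchy-Schwarz estimate diverges logarithmically; a weight in
  \<open>\<bar>s - s'\<bar>\<close> repairs it.\<close>

lemma powi_measurable_circ [measurable]: "(\<lambda>z::complex. z powi n) \<in> borel_measurable circ"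
  unfolding measurable_cong_sets[OF sets_circ refl]
  by (intro borel_measurable_continuous_on_restrict continuous_intros) auto

lemma square_integrable_powi: "square_integrable circ (\<lambda>z. z powi n)"
  by (rule square_integrable_circ_bounded[where B = 1]) (auto simp: norm_power_int)

lemma integral_circ:
  fixes f :: "complex \<Rightarrow> 'b::{banach, second_countable_topology}"
  assumes "f \<in> borel_measurable circ"
  shows "(LINT z|circ. f z) = (LINT x:{0..<2*pi}|lborel. f (cis x))"
proof -
  have "(LINT z|circ. f z) = (LINT x|restrict_space lborel {0..<2*pi}. f (cis x))"
    unfolding circ_def
    by (rule integral_distr) (use assms measurable_cong_sets[OF sets_circ refl] in auto)
  then show ?thesis
    by (simp add: integral_restrict_space set_lebesgue_integral_def)
qed

text \<open>The measure \<open>circ\<close> is arc length with total mass \<open>2*pi\<close>, not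
  normalised; this is the origin of the factors \<open>2*pi\<close> below.\<close>

lemma integral_circ_powi: "(LINT z|circ. z powi n) = (if n = 0 then 2*pi else 0)"
proof (cases "n = 0")
  case True
  have "(LINT z|circ. 1 :: complex) = (LINT x:{0..<2*pi}|lborel. 1)"
    by (rule integral_circ) simp
  also have "\<dots> = 2*pi" by (simp add: set_lebesgue_integral_def scaleR_conv_of_real)
  finally show ?thesis using True by (simp add: scaleR_conv_of_real)
next
  case False
  have m [measurable]: "(\<lambda>x. cis x powi n) \<in> borel_measurable borel"
    by (auto simp: cis_power_int intro!: borel_measurable_continuous_onI continuous_intros)
  have "(LINT z|circ. z powi n) = (LINT x:{0..<2*pi}|lborel. cis x powi n)"
    by (rule integral_circ) simp
  also have "\<dots> = (LINT x:{0..2*pi}|lborel. cis x powi n)"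
    unfolding set_lebesgue_integral_def
  proof (rule Bochner_Integration.integral_cong_AE)
    show "AE x in lborel. indicat_real {0..<2*pi} x *\<^sub>R cis x powi n = indicat_real {0..2*pi} x *\<^sub>R cis x powi n"
      by (rule AE_mp[OF AE_lborel_singleton[of "2*pi"]]) (auto simp: indicator_def)
  qed (use m in measurable)
  also have "\<dots> = (LINT x|lborel. indicat_real {0..2*pi} x *\<^sub>R cis (n * x))"
    unfolding set_lebesgue_integral_def by (simp add: cis_power_int)
  also have "\<dots> = cis (n * (2*pi)) / (\<i> * n) - cis (n * (0 :: real)) / (\<i> * n)"
  proof (rule integral_FTC_Icc[where F = "\<lambda>y. cis (n * y) / (\<i> * n)"])
    fix x :: real
    have "((\<lambda>y. cis (n * y) / (\<i> * n)) has_vector_derivative (n *\<^sub>R (\<i> * cis (n * x))) / (\<i> * n)) (at x within {0..2*pi})"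
      unfolding cis_conv_exp
      by (auto intro!: derivative_eq_intros has_vector_derivative_real_field simp: False scaleR_conv_of_real field_simps)
    then show "((\<lambda>y. cis (n * y) / (\<i> * n)) has_vector_derivative cis (n * x)) (at x within {0..2*pi})"
      using False by (simp add: scaleR_conv_of_real)
  qed (auto intro!: continuous_intros)
  also have "\<dots> = 0"
    using cis_multiple_2pi[of n] by (simp add: mult.commute mult.left_commute)
  finally show ?thesis using False by simp
qed

lemma cscale_L2_class:
  "square_integrable circ f \<Longrightarrow> cscale c (L2_class f) = L2_class (\<lambda>z. c * f z)"
  by (simp add: L2_class_def cscale.abs_eq L2rel_refl_iff square_integrable_cmult)

lemma fourier_coeff_L2_class:
  "square_integrable circ f \<Longrightarrow>
    fourier_coeff (L2_class f) n = (LINT z|circ. f z * cnj (z powi n)) / of_real (2*pi)"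
  by (simp add: L2_class_def fourier_coeff.abs_eq L2rel_refl_iff)

lemma inner_L2_class:
  "square_integrable circ f \<Longrightarrow> square_integrable circ g \<Longrightarrow>
    L2_class f \<bullet> L2_class g = (LINT z|circ. f z \<bullet> g z)"
  by (simp add: L2_class_def inner_L2T.abs_eq L2rel_refl_iff)

lemma square_integrable_cnj:
  "square_integrable M f \<Longrightarrow> square_integrable M (\<lambda>z. cnj (f z))"
  using borel_measurable_continuous_on[of cnj, OF continuous_on_cnj[OF continuous_on_id]]
  by (auto simp: square_integrable_def)

text \<open>\<open>L2T\<close> carries the real part of the Hermitian product, so
  \<open>c = 1\<close> and \<open>c = \<i>\<close> are both needed to recover a complex
  coefficient.\<close>

lemma inner_fourier_char:
  "x \<bullet> cscale c (fourier_char n) = 2*pi * Re (fourier_coeff x n * cnj c)"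
proof -
  obtain f where f: "square_integrable circ f" and x: "x = L2_class f"
    by (rule L2_class_surj)
  have I: "integrable circ (\<lambda>z. f z * cnj (z powi n))"
    by (intro square_integrable_integrable_mult f square_integrable_cnj square_integrable_powi)
  have "x \<bullet> cscale c (fourier_char n) = (LINT z|circ. f z \<bullet> (c * z powi n))"
    unfolding x fourier_char_def
    by (simp add: cscale_L2_class square_integrable_powi inner_L2_class f square_integrable_cmult)
  also have "\<dots> = (LINT z|circ. Re (f z * cnj (z powi n) * cnj c))"
    by (intro Bochner_Integration.integral_cong refl) (simp add: inner_complex_def algebra_simps del: complex_cnj_power_int)
  also have "\<dots> = Re (LINT z|circ. f z * cnj (z powi n) * cnj c)"
    by (rule integral_Re) (intro integrable_mult_left I)
  also have "(LINT z|circ. f z * cnj (z powi n) * cnj c) = (2*pi) * fourier_coeff x n * cnj c"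
    unfolding x by (simp add: fourier_coeff_L2_class f del: complex_cnj_power_int)
  finally show ?thesis by (simp add: mult.assoc)
qed

lemma fourier_coeff_conv_inner:
  "fourier_coeff x n = Complex (x \<bullet> cscale 1 (fourier_char n) / (2*pi)) (x \<bullet> cscale \<i> (fourier_char n) / (2*pi))"
  by (simp add: inner_fourier_char complex_eq_iff)

lemma bounded_linear_fourier_coeff: "bounded_linear (\<lambda>x. fourier_coeff x n)"
proof -
  have "bounded_linear (\<lambda>x. of_real (1/(2*pi)) * complex_of_real (x \<bullet> cscale 1 (fourier_char n))
      + (\<i> * of_real (1/(2*pi))) * complex_of_real (x \<bullet> cscale \<i> (fourier_char n)))"
    by (intro bounded_linear_add bounded_linear_const_mult
        bounded_linear_compose[OF bounded_linear_of_real bounded_linear_inner_left])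
  then show ?thesis
    by (simp add: fourier_coeff_conv_inner Complex_eq)
qed

lemma fourier_coeff_char: "fourier_coeff (cscale c (fourier_char m)) n = (if n = m then c else 0)"
proof -
  have "(LINT z|circ. c * z powi m * cnj (z powi n)) = (LINT z|circ. c * z powi (m - n))"
  proof (intro Bochner_Integration.integral_cong refl)
    fix z assume "z \<in> space circ"
    then have "z * cnj z = 1" "z \<noteq> 0"
      by (auto simp: complex_norm_square[symmetric])
    then have "cnj z = inverse z"
      by (metis inverse_unique)
    with \<open>z \<noteq> 0\<close> show "c * z powi m * cnj (z powi n) = c * z powi (m - n)"
      by (simp add: power_int_diff power_int_inverse divide_inverse)
  qed
  also have "\<dots> = c * (if m = n then 2*pi else 0)"
    by (simp add: integral_circ_powi)
  finally show ?thesis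
    unfolding fourier_char_def
    by (auto simp: cscale_L2_class square_integrable_powi fourier_coeff_L2_class square_integrable_cmult
        simp del: complex_cnj_power_int)
qed

lemma fourier_coeff_sum:
  "finite F \<Longrightarrow> fourier_coeff (\<Sum>m\<in>F. cscale (c m) (fourier_char m)) n = (if n \<in> F then c n else 0)"
  by (subst linear_sum[OF bounded_linear.linear[OF bounded_linear_fourier_coeff]])
    (simp add: fourier_coeff_char)

lemma norm_fourier_sum:
  assumes "finite F"
  shows "(norm (\<Sum>m\<in>F. cscale (c m) (fourier_char m)))\<^sup>2 = 2*pi * (\<Sum>m\<in>F. (cmod (c m))\<^sup>2)"
  unfolding power2_norm_eq_inner[where 'a = L2T]
  by (simp add: inner_sum_right inner_fourier_char fourier_coeff_sum assms
      sum_distrib_left cmod_power2 power2_eq_square[symmetric])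

section \<open>Bessel's inequality and Fourier series with square summable coefficients\<close>

lemma bessel:
  assumes "finite F"
  shows "2*pi * (\<Sum>m\<in>F. (cmod (fourier_coeff x m))\<^sup>2) \<le> (norm x)\<^sup>2"
proof -
  let ?p = "\<Sum>m\<in>F. cscale (fourier_coeff x m) (fourier_char m)"
  have "0 \<le> (norm (x - ?p))\<^sup>2" by simp
  also have "\<dots> = (norm x)\<^sup>2 - 2 * (x \<bullet> ?p) + (norm ?p)\<^sup>2"
    by (simp add: power2_norm_eq_inner inner_diff_left inner_diff_right inner_commute)
  also have "x \<bullet> ?p = 2*pi * (\<Sum>m\<in>F. (cmod (fourier_coeff x m))\<^sup>2)"
    by (simp add: inner_sum_right inner_fourier_char sum_distrib_left cmod_power2 power2_eq_square[symmetric])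
  finally show ?thesis
    by (simp add: norm_fourier_sum assms)
qed

text \<open>Absolute convergence may fail, so the net of finite partial sums is shown to be Cauchy:
  by orthogonality the norm of a block of terms is governed by the same block of the scalar series.
  Completeness of \<open>L2T\<close> gives the limit.\<close>

lemma fourier_series_summable:
  assumes "(\<lambda>n. (cmod (c n))\<^sup>2) summable_on A"
  shows "(\<lambda>n. cscale (c n) (fourier_char n)) summable_on A"
proof -
  let ?a = "\<lambda>n. (cmod (c n))\<^sup>2" and ?f = "\<lambda>n. cscale (c n) (fourier_char n)"
  have "\<exists>P. eventually P (finite_subsets_at_top A) \<and>
      (\<forall>F F'. P F \<and> P F' \<longrightarrow> dist (sum ?f F) (sum ?f F') < e)" if "e > 0" for e
  proof -
    \<comment> \<open>Then \<open>2*pi * d\<close> is \<open>(e/4)\<^sup>2\<close>, strictly below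
      the \<open>(e/2)\<^sup>2\<close> wanted in \<open>near\<close>.\<close>
    define d where "d = e\<^sup>2 / (32*pi)"
    have d: "d > 0" using that by (simp add: d_def)
    obtain F0 where F0: "finite F0" "F0 \<subseteq> A" "dist (sum ?a F0) (infsum ?a A) \<le> d"
      using infsum_finite_approximation[OF assms d] by blast
    define P where "P F \<longleftrightarrow> finite F \<and> F0 \<subseteq> F \<and> F \<subseteq> A" for F
    have near: "dist (sum ?f F) (sum ?f F0) < e/2" if F: "P F" for F
    proof -
      have F': "finite F" "F0 \<subseteq> F" "F \<subseteq> A" using F by (auto simp: P_def)
      have "sum ?a (F - F0) = sum ?a F - sum ?a F0"
        using F' by (simp add: sum_diff F0)
      also have "sum ?a F \<le> infsum ?a A"
        by (rule finite_sum_le_infsum[OF assms]) (use F' in auto)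
      also have "infsum ?a A - sum ?a F0 \<le> d"
        using F0 by (simp add: dist_real_def)
      finally have s: "sum ?a (F - F0) \<le> d" by simp
      have "dist (sum ?f F) (sum ?f F0) = norm (sum ?f (F - F0))"
        unfolding dist_norm using F' by (simp add: sum_diff F0)
      moreover have "(norm (sum ?f (F - F0)))\<^sup>2 = 2*pi * sum ?a (F - F0)"
        using F' by (simp add: norm_fourier_sum)
      moreover have "2*pi * sum ?a (F - F0) \<le> 2*pi * d" using s by simp
      moreover have "2*pi * d < (e/2)\<^sup>2" using \<open>e > 0\<close> by (simp add: d_def power_divide)
      ultimately have "(dist (sum ?f F) (sum ?f F0))\<^sup>2 < (e/2)\<^sup>2"
        by (metis order_le_less_trans)
      from power2_less_imp_less[OF this] show ?thesis
        using \<open>e > 0\<close> by linarith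
    qed
    have "eventually P (finite_subsets_at_top A)"
      unfolding eventually_finite_subsets_at_top P_def using F0(1,2) by (intro exI[of _ F0]) auto
    moreover have "dist (sum ?f F) (sum ?f F') < e" if "P F" "P F'" for F F'
      using near[OF that(1)] near[OF that(2)] dist_triangle2[of "sum ?f F" "sum ?f F'" "sum ?f F0"] by linarith
    ultimately show ?thesis by blast
  qed
  then have "cauchy_filter (filtermap (sum ?f) (finite_subsets_at_top A))"
    by (simp add: cauchy_filter_metric_filtermap)
  moreover have "complete (UNIV :: L2T set)"
    by (meson Cauchy_convergent UNIV_I complete_def convergent_def)
  ultimately obtain L where "(sum ?f \<longlongrightarrow> L) (finite_subsets_at_top A)"
    using complete_uniform[where S = UNIV] by (force simp add: filterlim_def)
  then show ?thesis
    using summable_on_def has_sum_def by blast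
qed

text \<open>Bessel's inequality supplies the hypothesis for both \<open>riesz_proj\<close> and
  \<open>semigroup_S\<close>, whose coefficients do not exceed those of the argument in modulus; so
  the infinite sums defining them are genuine limits.\<close>

lemma fourier_series_bounded:
  assumes le: "\<And>F. finite F \<Longrightarrow> F \<subseteq> A \<Longrightarrow> 2*pi * (\<Sum>m\<in>F. (cmod (c m))\<^sup>2) \<le> B\<^sup>2" and "B \<ge> 0"
  shows "(\<lambda>n. cscale (c n) (fourier_char n)) summable_on A"
    and "norm (\<Sum>\<^sub>\<infinity>n\<in>A. cscale (c n) (fourier_char n)) \<le> B"
    and "fourier_coeff (\<Sum>\<^sub>\<infinity>n\<in>A. cscale (c n) (fourier_char n)) m = (if m \<in> A then c m else 0)"
proof -
  let ?f = "\<lambda>n. cscale (c n) (fourier_char n)"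
  have "(\<lambda>n. (cmod (c n))\<^sup>2) summable_on A"
  proof (rule nonneg_bdd_above_summable_on)
    show "bdd_above (sum (\<lambda>n. (cmod (c n))\<^sup>2) ` {F. F \<subseteq> A \<and> finite F})"
      by (rule bdd_aboveI2[where M = "B\<^sup>2 / (2*pi)"]) (use le in \<open>auto simp: field_simps\<close>)
  qed simp
  then show s: "?f summable_on A" by (rule fourier_series_summable)
  have lim: "(sum ?f \<longlongrightarrow> infsum ?f A) (finite_subsets_at_top A)"
    using s by (rule infsum_tendsto)
  have "norm (sum ?f F) \<le> B" if "finite F" "F \<subseteq> A" for F
    using le[OF that] by (intro power2_le_imp_le[OF _ \<open>B \<ge> 0\<close>]) (simp add: norm_fourier_sum that)
  then show "norm (infsum ?f A) \<le> B"
    by (intro tendsto_upperbound[OF tendsto_norm[OF lim]] eventually_finite_subsets_at_top_weakI) auto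
  have "((\<lambda>n. fourier_coeff (?f n) m) has_sum fourier_coeff (infsum ?f A) m) A"
    by (rule has_sum_bounded_linear[OF bounded_linear_fourier_coeff]) (use s in simp)
  then have "((\<lambda>n. if n = m then c m else 0) has_sum fourier_coeff (infsum ?f A) m) A"
    by (rule has_sum_cong[THEN iffD1, rotated]) (auto simp: fourier_coeff_char)
  moreover have "((\<lambda>n. if n = m then c m else 0) has_sum (if m \<in> A then c m else 0)) A"
  proof (cases "m \<in> A")
    case True
    then have "((\<lambda>n. if n = m then c m else 0) has_sum (\<Sum>n\<in>{m}. if n = m then c m else 0)) A"
      by (intro has_sum_finite_neutralI[of "{m}"]) auto
    then show ?thesis using True by simp
  next
    case False
    then show ?thesis by (auto intro!: has_sum_0)
  qed
  ultimately show "fourier_coeff (infsum ?f A) m = (if m \<in> A then c m else 0)"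
    by (rule has_sum_unique)
qed

lemma
  shows norm_riesz_proj_le: "norm (riesz_proj x) \<le> norm x"
    and fourier_coeff_riesz_proj: "fourier_coeff (riesz_proj x) m = (if 0 \<le> m then fourier_coeff x m else 0)"
  using fourier_series_bounded[of "{0..}" "fourier_coeff x" "norm x"] bessel[of _ x]
  unfolding riesz_proj_def by auto

lemma
  assumes "t \<ge> 0"
  shows semigroup_S_summable:
      "(\<lambda>n. cscale (fourier_coeff x n * of_real (exp (- \<bar>real_of_int n\<bar> * t))) (fourier_char n)) summable_on UNIV"
    and norm_semigroup_S_le: "norm (semigroup_S t x) \<le> norm x"
    and fourier_coeff_semigroup_S: "fourier_coeff (semigroup_S t x) m = fourier_coeff x m * of_real (exp (- \<bar>real_of_int m\<bar> * t))"
proof -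
  have "2*pi * (\<Sum>m\<in>F. (cmod (fourier_coeff x m * of_real (exp (- \<bar>real_of_int m\<bar> * t))))\<^sup>2) \<le> (norm x)\<^sup>2" if "finite F" for F
  proof -
    have "cmod (fourier_coeff x m * of_real (exp (- \<bar>real_of_int m\<bar> * t))) \<le> cmod (fourier_coeff x m)" for m
      unfolding norm_mult using assms
      by (intro mult_left_le) auto
    then have "2*pi * (\<Sum>m\<in>F. (cmod (fourier_coeff x m * of_real (exp (- \<bar>real_of_int m\<bar> * t))))\<^sup>2)
        \<le> 2*pi * (\<Sum>m\<in>F. (cmod (fourier_coeff x m))\<^sup>2)"
      by (intro mult_left_mono sum_mono power_mono) auto
    also have "\<dots> \<le> (norm x)\<^sup>2" by (rule bessel[OF that])
    finally show ?thesis .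
  qed
  then show
    "(\<lambda>n. cscale (fourier_coeff x n * of_real (exp (- \<bar>real_of_int n\<bar> * t))) (fourier_char n)) summable_on UNIV"
    "norm (semigroup_S t x) \<le> norm x"
    "fourier_coeff (semigroup_S t x) m = fourier_coeff x m * of_real (exp (- \<bar>real_of_int m\<bar> * t))"
    unfolding semigroup_S_def
    using fourier_series_bounded[of UNIV "\<lambda>m. fourier_coeff x m * of_real (exp (- \<bar>real_of_int m\<bar> * t))" "norm x"]
    by auto
qed

lemma cscale_zero [simp]: "cscale 0 x = 0"
  by transfer (auto simp: L2rel_def)

section \<open>Null controllability as a moment problem\<close>

text \<open>\<open>L2T\<close> is only a real vector space as a type; splitting the complex scalar
  makes the library rules for \<open>scaleR\<close>, here measurability, applicable.\<close>

lemma cscale_conv_scaleR: "cscale c x = Re c *\<^sub>R x + Im c *\<^sub>R cscale \<i> x"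
  by transfer (rule L2rel_I, auto simp: L2rel_refl_iff square_integrable_cmult complex_eq_iff)

lemma borel_measurable_cscale [measurable (raw)]:
  assumes [measurable]: "c \<in> borel_measurable M"
  shows "(\<lambda>x. cscale (c x) e) \<in> borel_measurable M"
  by (subst cscale_conv_scaleR) measurable

text \<open>No negative frequency survives \<open>riesz_proj\<close>, so the unordered sum over the
  integers becomes an ordinary series; its partial sums serve for inner products and for
  measurability in time.\<close>

lemma semigroup_riesz_sums:
  assumes "t \<ge> 0"
  shows "(\<lambda>k. cscale (fourier_coeff x (int k) * of_real (exp (- real k * t))) (fourier_char (int k)))
    sums semigroup_S t (riesz_proj x)"
proof -
  let ?g = "\<lambda>n. cscale (fourier_coeff (riesz_proj x) n * of_real (exp (- \<bar>real_of_int n\<bar> * t))) (fourier_char n)"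
  have "(?g has_sum semigroup_S t (riesz_proj x)) UNIV"
    unfolding semigroup_S_def by (rule has_sum_infsum[OF semigroup_S_summable[OF assms]])
  then have "(?g has_sum semigroup_S t (riesz_proj x)) {0..}"
    by (rule has_sum_cong_neutral[THEN iffD1, rotated 3]) (auto simp: fourier_coeff_riesz_proj)
  also have "{0..} = range int"
    by (auto simp: image_iff dest: zero_le_imp_eq_int)
  finally have "((?g \<circ> int) has_sum semigroup_S t (riesz_proj x)) UNIV"
    by (subst (asm) has_sum_reindex) auto
  then show ?thesis
    by (drule_tac has_sum_imp_sums) (simp add: o_def fourier_coeff_riesz_proj)
qed

text \<open>Later \<open>h\<close> is itself built from such vectors, so this yields
  \<open>h \<bullet> h = 0\<close>. A vector with vanishing coefficients is thereby seen to be 0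
  without proving the trigonometric system complete.\<close>

lemma inner_semigroup_riesz_eq_0:
  assumes "t \<ge> 0" and "\<And>k :: nat. fourier_coeff h (int k) = 0"
  shows "h \<bullet> semigroup_S t (riesz_proj x) = 0"
proof -
  have "(\<lambda>k. h \<bullet> cscale (fourier_coeff x (int k) * of_real (exp (- real k * t))) (fourier_char (int k)))
      sums (h \<bullet> semigroup_S t (riesz_proj x))"
    by (rule bounded_linear.sums[OF bounded_linear_inner_right semigroup_riesz_sums[OF assms(1)]])
  then have "(\<lambda>k. 0 :: real) sums (h \<bullet> semigroup_S t (riesz_proj x))"
    by (simp add: inner_fourier_char assms(2))
  then show ?thesis using sums_unique2 sums_zero by blast
qed

section \<open>Controls as square integrable functions on the cylinder\<close>

lemma pair_measure_restrict_space:
  assumes "sigma_finite_measure M" "sigma_finite_measure N" and A: "A \<in> sets M" and B: "B \<in> sets N"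
  shows "restrict_space M A \<Otimes>\<^sub>M restrict_space N B = restrict_space (M \<Otimes>\<^sub>M N) (A \<times> B)" (is "?L = ?R")
proof (rule pair_measure_eqI)
  interpret N: sigma_finite_measure N by fact
  note [simp] = sets.sets_into_space[OF A] sets.sets_into_space[OF B]
  show "sigma_finite_measure (restrict_space M A)" "sigma_finite_measure (restrict_space N B)"
    by (auto intro!: sigma_finite_measure_restrict_space assms)
  have AB: "A \<times> B \<in> sets (M \<Otimes>\<^sub>M N)" using A B by simp
  have "fst \<in> measurable ?R (restrict_space M A)" "snd \<in> measurable ?R (restrict_space N B)"
    by (rule measurable_restrict_space2; use AB in \<open>auto intro: measurable_restrict_space1\<close>)+
  then have RL: "(\<lambda>x. x) \<in> measurable ?R ?L"
    unfolding measurable_pair_iff by (simp add: comp_def)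
  have LR: "(\<lambda>x. x) \<in> measurable ?L ?R"
  proof (rule measurable_restrict_space2)
    have "fst \<in> measurable ?L M" "snd \<in> measurable ?L N"
      using measurable_compose[OF measurable_fst measurable_restrict_space1[OF measurable_ident]]
        measurable_compose[OF measurable_snd measurable_restrict_space1[OF measurable_ident]] by (auto simp: id_def)
    then show "(\<lambda>x. x) \<in> measurable ?L (M \<Otimes>\<^sub>M N)"
      unfolding measurable_pair_iff by (simp add: comp_def)
  qed (auto simp: space_pair_measure A B)
  have sp: "space ?L = space ?R"
    using A B AB by (simp add: space_pair_measure)
  \<comment> \<open>Measurability of the identity map is inclusion of sigma-algebras; applied in
    both directions it gives equality.\<close>
  have "sets Y \<subseteq> sets X" if "(\<lambda>x. x) \<in> measurable X Y" "space X = space Y" for X Y :: "('a \<times> 'b) measure"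
    using measurable_sets[OF that(1)] sets.sets_into_space[of _ Y] that(2)
    by (metis Int_absorb2 subsetI vimage_ident)
  from this[OF RL sp[symmetric]] this[OF LR sp] show "sets ?L = sets ?R" by simp
  show "emeasure (restrict_space M A) C * emeasure (restrict_space N B) D = emeasure ?R (C \<times> D)"
    if "C \<in> sets (restrict_space M A)" "D \<in> sets (restrict_space N B)" for C D
  proof -
    have C: "C \<in> sets M" "C \<subseteq> A" and D: "D \<in> sets N" "D \<subseteq> B"
      using that A B by (auto simp: sets_restrict_space_iff)
    then show ?thesis
      using A B AB by (simp add: emeasure_restrict_space N.emeasure_pair_measure_Times Times_subset_cancel2 Sigma_mono)
  qed
qed

text \<open>Logarithmic polar coordinates: through \<open>disk_point\<close> the points with
  positive first entry fill the punctured unit disk, and that entry is both the time and minus the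
  logarithm of the radius.\<close>

abbreviation cyl :: "(real \<times> complex) measure" where
  "cyl \<equiv> lborel \<Otimes>\<^sub>M circ"

interpretation circ: finite_measure circ by (rule finite_measure_circ)
interpretation cyl: pair_sigma_finite lborel circ ..
interpretation cyl: sigma_finite_measure cyl by (rule sigma_finite_pair_measure) unfold_locales

text \<open>Extension by zero puts the controls for all time horizons on one measure space, so that
  those for \<open>T\<close> and \<open>T'\<close> can be compared.\<close>

lemma is_control_iff:
  assumes "\<omega> \<in> sets circ"
  shows "is_control \<omega> T u \<longleftrightarrow> square_integrable cyl (\<lambda>p. if p \<in> {0..T} \<times> \<omega> then u p else 0)"
proof -
  have R: "{0..T} \<times> \<omega> \<inter> space cyl \<in> sets cyl" using assms by auto
  have eq: "(\<lambda>p. indicat_real ({0..T} \<times> \<omega>) p *\<^sub>R (cmod (u p))\<^sup>2) = (\<lambda>p. (cmod (if p \<in> {0..T} \<times> \<omega> then u p else 0))\<^sup>2)"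
    by (auto simp: indicator_def)
  have pm: "restrict_space lborel {0..T} \<Otimes>\<^sub>M restrict_space circ \<omega> = restrict_space cyl ({0..T} \<times> \<omega>)"
    by (rule pair_measure_restrict_space) (use assms in \<open>auto simp: lborel.sigma_finite_measure_axioms circ.sigma_finite_measure_axioms\<close>)
  have m: "u \<in> borel_measurable (restrict_space cyl ({0..T} \<times> \<omega>)) \<longleftrightarrow>
      (\<lambda>p. if p \<in> {0..T} \<times> \<omega> then u p else 0) \<in> borel_measurable cyl"
    by (rule measurable_restrict_space_iff[OF R]) simp
  have i: "integrable (restrict_space cyl ({0..T} \<times> \<omega>)) (\<lambda>p. (cmod (u p))\<^sup>2) \<longleftrightarrow>
      integrable cyl (\<lambda>p. (cmod (if p \<in> {0..T} \<times> \<omega> then u p else 0))\<^sup>2)"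
    unfolding integrable_restrict_space[OF R] set_integrable_def eq ..
  show ?thesis
    unfolding is_control_def square_integrable_def pm m i ..
qed

lemma emeasure_strip: "emeasure cyl ({a..b} \<times> space circ) < \<infinity>"
proof -
  have "emeasure cyl ({a..b} \<times> space circ) = emeasure lborel {a..b} * emeasure circ (space circ)"
    by (rule circ.emeasure_pair_measure_Times[OF _ sets.top]) auto
  also have "\<dots> < \<infinity>"
    by (simp add: ennreal_mult_eq_top_iff emeasure_lborel_Icc_eq circ.emeasure_finite less_top[symmetric] del: space_circ)
  finally show ?thesis .
qed

lemma square_integrable_strip:
  assumes g: "g \<in> borel_measurable cyl"
    and le: "\<And>p. fst p \<in> {a..b} \<Longrightarrow> cmod (snd p) = 1 \<Longrightarrow> cmod (g p) \<le> B"
  shows "square_integrable cyl (\<lambda>p. indicator {a..b} (fst p) *\<^sub>R g p)"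
proof (rule square_integrable_bound[where w = "\<lambda>p. B\<^sup>2 * indicator ({a..b} \<times> space circ) p"])
  show "integrable cyl (\<lambda>p. B\<^sup>2 * indicator ({a..b} \<times> space circ) p)"
    using emeasure_strip
    by (intro integrable_mult_right integrable_real_indicator pair_measureI sets.top) auto
  show "AE p in cyl. (cmod (indicator {a..b} (fst p) *\<^sub>R g p))\<^sup>2 \<le> B\<^sup>2 * indicator ({a..b} \<times> space circ) p"
    by (rule AE_I2) (use le in \<open>auto simp: indicator_def space_pair_measure intro!: power_mono\<close>)
qed (use g in measurable)

text \<open>On the unit circle \<open>cnj z = 1 / z\<close>, so \<open>inv_point p\<close> is the inverse of \<open>disk_point p\<close>.\<close>

definition disk_point :: "real \<times> complex \<Rightarrow> complex" where
  "disk_point p = of_real (exp (- fst p)) * snd p"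

definition inv_point :: "real \<times> complex \<Rightarrow> complex" where
  "inv_point p = of_real (exp (fst p)) * cnj (snd p)"

lemma cnj_borel [measurable]: "cnj \<in> borel_measurable borel"
  by (intro borel_measurable_continuous_onI continuous_intros)

lemma ident_measurable_circ [measurable]: "(\<lambda>z. z) \<in> borel_measurable circ"
  by (rule borel_measurable_circI) simp

lemma snd_measurable_cyl [measurable]: "snd \<in> borel_measurable cyl"
  using measurable_compose[OF measurable_snd ident_measurable_circ] .

lemma disk_point_measurable [measurable]: "disk_point \<in> borel_measurable cyl"
  unfolding disk_point_def by measurable

lemma inv_point_measurable [measurable]: "inv_point \<in> borel_measurable cyl"
  unfolding inv_point_def by measurable

lemma square_integrable_times_bounded:
  assumes U: "square_integrable cyl U" and U0: "\<And>p. fst p \<notin> {a..b} \<Longrightarrow> U p = 0"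
    and g: "g \<in> borel_measurable cyl"
    and le: "\<And>p. fst p \<in> {a..b} \<Longrightarrow> cmod (snd p) = 1 \<Longrightarrow> cmod (g p) \<le> B"
  shows "integrable cyl (\<lambda>p. U p * g p)"
proof -
  have "integrable cyl (\<lambda>p. U p * (indicator {a..b} (fst p) *\<^sub>R g p))"
    by (rule square_integrable_integrable_mult[OF U square_integrable_strip[OF g le]])
  also have "(\<lambda>p. U p * (indicator {a..b} (fst p) *\<^sub>R g p)) = (\<lambda>p. U p * g p)"
    using U0 by (auto simp: indicator_def)
  finally show ?thesis .
qed

lemma cmod_inv_point_power:
  assumes "fst p \<in> {0..T}" "cmod (snd p) = 1"
  shows "cmod (inv_point p ^ n) \<le> exp T ^ n"
  unfolding inv_point_def using assms by (auto simp: norm_power norm_mult intro!: power_mono)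

lemma square_integrable_slice_iff:
  assumes [measurable]: "U \<in> borel_measurable cyl"
  shows "square_integrable circ (\<lambda>z. U (s, z)) \<longleftrightarrow> (\<integral>\<^sup>+z. ennreal ((cmod (U (s, z)))\<^sup>2) \<partial>circ) < \<infinity>"
  unfolding square_integrable_def integrable_iff_bounded by (simp add: measurable_Pair2)

lemma fourier_coeff_zero [simp]: "fourier_coeff 0 n = 0"
  using linear_0[OF bounded_linear.linear[OF bounded_linear_fourier_coeff]] .

lemma fourier_coeff_add: "fourier_coeff (x + y) n = fourier_coeff x n + fourier_coeff y n"
  using linear_add[OF bounded_linear.linear[OF bounded_linear_fourier_coeff]] .

text \<open>\<open>L2_class\<close> takes its default value on slices that are not square
  integrable. Those times form a measurable set, so the case distinction does no harm.\<close>

lemma fourier_coeff_slice_measurable: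
  assumes U [measurable]: "U \<in> borel_measurable cyl"
  shows "(\<lambda>s. fourier_coeff (L2_class (\<lambda>z. U (s, z))) n) \<in> borel_measurable lborel"
proof -
  have [measurable]: "(\<lambda>z. cnj (z powi n)) \<in> borel_measurable circ"
    using measurable_compose[OF powi_measurable_circ cnj_borel] .
  have eq: "fourier_coeff (L2_class (\<lambda>z. U (s, z))) n =
     (if (\<integral>\<^sup>+z. ennreal ((cmod (U (s, z)))\<^sup>2) \<partial>circ) < \<infinity>
      then (LINT z|circ. U (s, z) * cnj (z powi n)) / of_real (2*pi) else 0)" for s
    unfolding square_integrable_slice_iff[OF U, symmetric]
    using fourier_coeff_L2_class[of "\<lambda>z. U (s, z)" n] by (simp add: L2_class_def)
  show ?thesis
    unfolding eq by measurable
qed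

text \<open>Each partial sum is a finite combination of fixed vectors with measurable scalar
  coefficients, and the map is their pointwise limit. The indicator confines \<open>s\<close> to
  times with \<open>T - s \<ge> 0\<close>, where the series converges.\<close>

lemma semigroup_riesz_slice_measurable:
  assumes U: "U \<in> borel_measurable cyl"
  shows "(\<lambda>s. indicator {0..T} s *\<^sub>R semigroup_S (T - s) (riesz_proj (L2_class (\<lambda>z. U (s, z))))) \<in> borel_measurable lborel"
proof (rule borel_measurable_LIMSEQ_metric)
  note [measurable] = fourier_coeff_slice_measurable[OF U]
  show "(\<lambda>s. indicator {0..T} s *\<^sub>R (\<Sum>k<N. cscale (fourier_coeff (L2_class (\<lambda>z. U (s, z))) (int k) * of_real (exp (- real k * (T - s))))
      (fourier_char (int k)))) \<in> borel_measurable lborel" for N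
    by measurable
  show "(\<lambda>N. indicator {0..T} s *\<^sub>R (\<Sum>k<N. cscale (fourier_coeff (L2_class (\<lambda>z. U (s, z))) (int k) * of_real (exp (- real k * (T - s))))
      (fourier_char (int k)))) \<longlonglongrightarrow> indicator {0..T} s *\<^sub>R semigroup_S (T - s) (riesz_proj (L2_class (\<lambda>z. U (s, z))))" for s
  proof (cases "s \<in> {0..T}")
    case True
    then have "T - s \<ge> 0" by simp
    from semigroup_riesz_sums[OF this] show ?thesis
      unfolding sums_def by (rule tendsto_scaleR[OF tendsto_const])
  qed simp
qed

text \<open>Only the squared norm is known to be integrable in time; the crude bound of a root by
  \<open>1\<close> plus its square gives an integrable majorant on \<open>{0..T}\<close>, valid for
  default slices too.\<close>

lemma norm_L2_class_slice_le:
  assumes "U \<in> borel_measurable cyl"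
  shows "norm (L2_class (\<lambda>z. U (s, z))) \<le> 1 + (LINT z|circ. (cmod (U (s, z)))\<^sup>2)"
proof (cases "square_integrable circ (\<lambda>z. U (s, z))")
  case True
  let ?I = "LINT z|circ. (cmod (U (s, z)))\<^sup>2"
  have "0 \<le> ?I" by simp
  then have "sqrt ?I \<le> 1 + ?I"
    by (intro real_le_lsqrt) (auto simp: power2_eq_square algebra_simps)
  then show ?thesis by (simp add: norm_L2_class[OF True])
qed (simp add: L2_class_def)

lemma semigroup_riesz_slice_integrable:
  assumes U: "square_integrable cyl U"
  shows "integrable lborel (\<lambda>s. indicator {0..T} s *\<^sub>R semigroup_S (T - s) (riesz_proj (L2_class (\<lambda>z. U (s, z)))))"
proof (rule Bochner_Integration.integrable_bound)
  have m: "U \<in> borel_measurable cyl" using U by (simp add: square_integrable_def)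
  have "integrable lborel (\<lambda>s. LINT z|circ. (cmod (U (s, z)))\<^sup>2)"
    using U cyl.integrable_fst'[of "\<lambda>p. (cmod (U p))\<^sup>2"] by (simp add: square_integrable_def)
  then show "integrable lborel (\<lambda>s. indicator {0..T} s + (LINT z|circ. (cmod (U (s, z)))\<^sup>2))"
    by (intro Bochner_Integration.integrable_add integrable_real_indicator) (auto simp: emeasure_lborel_Icc_eq)
  show "(\<lambda>s. indicator {0..T} s *\<^sub>R semigroup_S (T - s) (riesz_proj (L2_class (\<lambda>z. U (s, z))))) \<in> borel_measurable lborel"
    by (rule semigroup_riesz_slice_measurable[OF m])
  show "AE s in lborel. norm (indicator {0..T} s *\<^sub>R semigroup_S (T - s) (riesz_proj (L2_class (\<lambda>z. U (s, z)))))
      \<le> norm (indicator {0..T} s + (LINT z|circ. (cmod (U (s, z)))\<^sup>2))"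
  proof (rule AE_I2)
    fix s
    have nonneg: "0 \<le> (LINT z|circ. (cmod (U (s, z)))\<^sup>2)" by simp
    show "norm (indicator {0..T} s *\<^sub>R semigroup_S (T - s) (riesz_proj (L2_class (\<lambda>z. U (s, z)))))
      \<le> norm (indicator {0..T} s + (LINT z|circ. (cmod (U (s, z)))\<^sup>2))"
    proof (cases "s \<in> {0..T}")
      case True
      then have "norm (semigroup_S (T - s) (riesz_proj (L2_class (\<lambda>z. U (s, z))))) \<le> norm (L2_class (\<lambda>z. U (s, z)))"
        using order_trans[OF norm_semigroup_S_le norm_riesz_proj_le] by simp
      also have "\<dots> \<le> 1 + (LINT z|circ. (cmod (U (s, z)))\<^sup>2)"
        by (rule norm_L2_class_slice_le[OF m])
      finally show ?thesis using True nonneg by simp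
    qed (use nonneg in simp)
  qed
qed

text \<open>Each coefficient passes through the Bochner integral and becomes, by Fubini, a moment
  over the cylinder times the nonzero factor \<open>exp (- real n * T) / (2*pi)\<close>.\<close>

lemma H2_solution_eq_0_iff:
  assumes \<omega>: "\<omega> \<in> sets circ" and "0 \<le> T" and f0: "f0 \<in> H2" and u: "is_control \<omega> T u"
  shows "H2_solution \<omega> u f0 T = 0 \<longleftrightarrow>
    (\<forall>n. 2*pi * fourier_coeff f0 (int n) +
      (LINT p|cyl. (if p \<in> {0..T} \<times> \<omega> then u p else 0) * inv_point p ^ n) = 0)"
proof -
  define U where "U p = (if p \<in> {0..T} \<times> \<omega> then u p else 0)" for p
  have U: "square_integrable cyl U"
    using u unfolding is_control_iff[OF \<omega>] U_def .
  then have m [measurable]: "U \<in> borel_measurable cyl" by (simp add: square_integrable_def)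
  define y where "y s = indicat_real {0..T} s *\<^sub>R semigroup_S (T - s) (riesz_proj (L2_class (\<lambda>z. U (s, z))))" for s
  have y: "integrable lborel y"
    unfolding y_def by (rule semigroup_riesz_slice_integrable[OF U])
  obtain x0 where x0: "f0 = riesz_proj x0" using f0 by (auto simp: H2_def)
  define h where "h = H2_solution \<omega> u f0 T"
  have "(\<lambda>s. indicat_real {0..T} s *\<^sub>R semigroup_S (T - s) (riesz_proj (L2_class (\<lambda>z. if z \<in> \<omega> then u (s, z) else 0)))) = y"
  proof
    fix s
    show "indicat_real {0..T} s *\<^sub>R semigroup_S (T - s) (riesz_proj (L2_class (\<lambda>z. if z \<in> \<omega> then u (s, z) else 0))) = y s"
      by (cases "s \<in> {0..T}") (auto simp: y_def U_def)
  qed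
  then have h: "h = semigroup_S T f0 + (LINT s|lborel. y s)"
    by (simp add: h_def H2_solution_def set_lebesgue_integral_def)
  have int: "integrable cyl (\<lambda>p. U p * inv_point p ^ n)" for n
    by (rule square_integrable_times_bounded[OF U _ _ cmod_inv_point_power[of _ T]]) (auto simp: U_def)
  \<comment> \<open>The weight \<open>exp (- real n * (T - s))\<close> splits into
    \<open>exp (- real n * T)\<close>, which factors out, and \<open>exp (real n * s)\<close>, which
    together with the conjugate character forms \<open>inv_point (s, z) ^ n\<close>.\<close>
  have coeff: "fourier_coeff h (int n) = exp (- real n * T) / (2*pi) *
      (2*pi * fourier_coeff f0 (int n) + (LINT p|cyl. U p * inv_point p ^ n))" for n
  proof -
    have "AE s in lborel. integrable circ (\<lambda>z. (cmod (U (s, z)))\<^sup>2)"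
      using U cyl.AE_integrable_fst'[of "\<lambda>p. (cmod (U p))\<^sup>2"] by (simp add: square_integrable_def)
    then have ae: "AE s in lborel. fourier_coeff (y s) (int n) =
        exp (- real n * T) / (2*pi) * (LINT z|circ. U (s, z) * inv_point (s, z) ^ n)"
    proof (rule AE_mp, intro AE_I2 impI)
      fix s assume "integrable circ (\<lambda>z. (cmod (U (s, z)))\<^sup>2)"
      then have sq: "square_integrable circ (\<lambda>z. U (s, z))"
        by (simp add: square_integrable_def measurable_Pair2)
      show "fourier_coeff (y s) (int n) =
        exp (- real n * T) / (2*pi) * (LINT z|circ. U (s, z) * inv_point (s, z) ^ n)"
      proof (cases "s \<in> {0..T}")
        case True
        have eq: "U (s, z) * inv_point (s, z) ^ n = exp (real n * s) * (U (s, z) * cnj (z powi int n))" for z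
          by (simp add: inv_point_def power_mult_distrib exp_of_nat_mult)
        have "(LINT z|circ. U (s, z) * inv_point (s, z) ^ n) =
            exp (real n * s) * (LINT z|circ. U (s, z) * cnj (z powi int n))"
          unfolding eq by (rule integral_mult_right_zero)
        also have "\<dots> = exp (real n * s) * (2*pi * fourier_coeff (L2_class (\<lambda>z. U (s, z))) (int n))"
          unfolding fourier_coeff_L2_class[OF sq] by simp
        finally have "(LINT z|circ. U (s, z) * inv_point (s, z) ^ n) =
            exp (real n * s) * (2*pi * fourier_coeff (L2_class (\<lambda>z. U (s, z))) (int n))" .
        moreover have "fourier_coeff (y s) (int n) =
            fourier_coeff (L2_class (\<lambda>z. U (s, z))) (int n) * exp (- real n * (T - s))"
          using True by (simp add: y_def fourier_coeff_semigroup_S fourier_coeff_riesz_proj)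
        moreover have "exp (- real n * (T - s)) = exp (- real n * T) * exp (real n * s)"
          by (simp add: exp_add[symmetric] algebra_simps)
        ultimately show ?thesis by simp
      next
        case False
        then have "U (s, z) = 0" for z by (auto simp: U_def)
        then show ?thesis using False by (simp add: y_def)
      qed
    qed
    have "fourier_coeff (LINT s|lborel. y s) (int n) = (LINT s|lborel. fourier_coeff (y s) (int n))"
      by (rule integral_bounded_linear[OF bounded_linear_fourier_coeff y, symmetric])
    also have "\<dots> = (LINT s|lborel. exp (- real n * T) / (2*pi) * (LINT z|circ. U (s, z) * inv_point (s, z) ^ n))"
    proof (rule Bochner_Integration.integral_cong_AE[OF _ _ ae])
      show "(\<lambda>s. fourier_coeff (y s) (int n)) \<in> borel_measurable lborel"
        by (rule borel_measurable_integrable[OF integrable_bounded_linear[OF bounded_linear_fourier_coeff y]])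
      show "(\<lambda>s. exp (- real n * T) / (2*pi) * (LINT z|circ. U (s, z) * inv_point (s, z) ^ n)) \<in> borel_measurable lborel"
        by (rule borel_measurable_integrable[OF integrable_mult_right[OF cyl.integrable_fst'[OF int]]])
    qed
    also have "\<dots> = exp (- real n * T) / (2*pi) * (LINT p|cyl. U p * inv_point p ^ n)"
      by (simp add: cyl.integral_fst'[OF int])
    finally show ?thesis
      unfolding h using fourier_coeff_semigroup_S[OF \<open>0 \<le> T\<close>, of f0 "int n"]
      by (simp add: fourier_coeff_add field_simps)
  qed
  have "h = 0 \<longleftrightarrow> (\<forall>n. fourier_coeff h (int n) = 0)"
  proof
    assume "\<forall>n. fourier_coeff h (int n) = 0"
    then have 0: "h \<bullet> semigroup_S t (riesz_proj x) = 0" if "t \<ge> 0" for t x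
      using that by (intro inner_semigroup_riesz_eq_0) auto
    \<comment> \<open>\<open>h\<close> is the sum of \<open>semigroup_S T f0\<close> and an integral
      of vectors covered by \<open>0\<close>, hence orthogonal to itself.\<close>
    have "h \<bullet> (LINT s|lborel. y s) = (LINT s|lborel. h \<bullet> y s)"
      using y by simp
    also have "(\<lambda>s. h \<bullet> y s) = (\<lambda>s. 0)"
    proof
      show "h \<bullet> y s = 0" for s
        by (cases "s \<in> {0..T}") (auto simp: y_def 0)
    qed
    finally have "h \<bullet> h = 0"
      using 0[OF \<open>0 \<le> T\<close>, of x0] h by (metis add.right_neutral inner_add_right x0 integral_zero)
    then show "h = 0" by simp
  qed simp
  then show ?thesis
    unfolding h_def[symmetric] U_def[symmetric] coeff by simp
qed

section \<open>The Cauchy kernel on the cylinder\<close>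

text \<open>Geometric decay of the coefficients justifies integrating term by term; only the terms
  with exponent 0 survive.\<close>

lemma integral_circ_series:
  assumes a: "\<And>k. cmod (a k) \<le> B * r ^ k" and r: "0 \<le> r" "r < 1"
  shows "(\<lambda>k. a k * (if m k = 0 then 2*pi else 0)) sums (LINT z|circ. (\<Sum>k. a k * z powi m k))"
proof -
  have i: "integrable circ (\<lambda>z. a k * z powi m k)" for k
    by (intro integrable_mult_right circ.integrable_const_bound[where B = 1] AE_I2)
      (auto simp: norm_power_int)
  have n: "norm (a k * z powi m k) = cmod (a k)" if "z \<in> space circ" for k z
    using that by (simp add: norm_mult norm_power_int)
  have s: "summable (\<lambda>k. cmod (a k))"
    by (rule summable_comparison_test'[OF summable_mult[OF summable_geometric[of r], of B]]) (use a r in auto)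
  have "(\<lambda>k. LINT z|circ. a k * z powi m k) sums (LINT z|circ. (\<Sum>k. a k * z powi m k))"
  proof (rule sums_integral[OF i])
    show "AE z in circ. summable (\<lambda>k. norm (a k * z powi m k))"
      by (rule AE_I2) (use s in \<open>simp only: n\<close>)
    have "(LINT z|circ. norm (a k * z powi m k)) = cmod (a k) * measure circ (space circ)" for k
      using n by (subst Bochner_Integration.integral_cong[OF refl]) auto
    then show "summable (\<lambda>k. LINT z|circ. norm (a k * z powi m k))"
      using summable_mult2[OF s] by simp
  qed
  moreover have "(LINT z|circ. a k * z powi m k) = a k * (if m k = 0 then 2*pi else 0)" for k
    by (simp add: integral_circ_powi)
  ultimately show ?thesis by (simp only:)
qed

text \<open>For \<open>cmod w < 1\<close> the kernel expands in powers of \<open>z * w\<close>, and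
  \<open>k = n\<close> is the only constant term. For \<open>cmod w > 1\<close> it expands in
  negative powers, all of which stay negative after multiplication by \<open>cnj z ^ n\<close>. The
  jump between the two cases carries the whole argument.\<close>

lemma integral_circ_kernel:
  fixes w :: complex
  assumes "cmod w \<noteq> 1"
  shows "(LINT z|circ. cnj z ^ n / (1 - z * w)) = (if cmod w < 1 then 2*pi * w ^ n else 0)"
proof (cases "cmod w < 1")
  case True
  have "(\<lambda>k. w ^ k * (if int k - int n = 0 then 2*pi else 0)) sums (LINT z|circ. (\<Sum>k. w ^ k * z powi (int k - int n)))"
    by (rule integral_circ_series[of _ 1 "cmod w"]) (use True in \<open>auto simp: norm_power\<close>)
  also have "(\<lambda>k. w ^ k * (if int k - int n = 0 then 2*pi else 0)) = (\<lambda>k. if k = n then 2*pi * w ^ n else 0)"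
    by auto
  finally have "(LINT z|circ. (\<Sum>k. w ^ k * z powi (int k - int n))) = 2*pi * w ^ n"
    using sums_unique2 sums_single[of n "\<lambda>_. 2*pi * w ^ n"] by blast
  moreover have "(\<Sum>k. w ^ k * z powi (int k - int n)) = cnj z ^ n / (1 - z * w)" if "z \<in> space circ" for z
  proof -
    have z: "z * cnj z = 1" "z \<noteq> 0" using that by (auto simp: complex_norm_square[symmetric])
    then have "cnj z = inverse z" by (metis inverse_unique)
    then have "w ^ k * z powi (int k - int n) = cnj z ^ n * (z * w) ^ k" for k
      using z by (simp add: power_int_diff power_mult_distrib divide_inverse power_inverse)
    moreover have "cmod (z * w) < 1" using that True by (simp add: norm_mult)
    ultimately show ?thesis
      by (simp add: suminf_mult suminf_geometric summable_geometric divide_inverse)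
  qed
  ultimately show ?thesis
    using True Bochner_Integration.integral_cong[OF refl] by (metis (no_types, lifting))
next
  case False
  then have w: "cmod w > 1" using assms by simp
  then have "w \<noteq> 0" by auto
  \<comment> \<open>This is 1 / (1 - q) as minus the sum of q^(-k-1), with q = \<open>z * w\<close>;
    the shift by one keeps the exponent away from 0 even for \<open>n = k = 0\<close>.\<close>
  have "(\<lambda>k. - ((1 / w) ^ (k + 1)) * (if - int (n + k + 1) = 0 then 2*pi else 0)) sums (LINT z|circ. (\<Sum>k. - ((1 / w) ^ (k + 1)) * z powi (- int (n + k + 1))))"
  proof (rule integral_circ_series[of _ 1 "cmod (1 / w)"])
    show "cmod (- ((1 / w) ^ (k + 1))) \<le> 1 * cmod (1 / w) ^ k" for k
      unfolding norm_minus_cancel norm_power mult_1 using w by (intro power_decreasing) (auto simp: norm_divide divide_le_eq)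
  qed (use w in \<open>auto simp: norm_divide divide_less_eq\<close>)
  also have "(\<lambda>k. - ((1 / w) ^ (k + 1)) * (if - int (n + k + 1) = 0 then 2*pi else 0)) = (\<lambda>k. 0)"
    by auto
  finally have "(LINT z|circ. (\<Sum>k. - ((1 / w) ^ (k + 1)) * z powi (- int (n + k + 1)))) = 0"
    using sums_unique2 sums_zero by blast
  moreover have "(\<Sum>k. - ((1 / w) ^ (k + 1)) * z powi (- int (n + k + 1))) = cnj z ^ n / (1 - z * w)" if "z \<in> space circ" for z
  proof -
    have z: "z * cnj z = 1" "z \<noteq> 0" using that by (auto simp: complex_norm_square[symmetric])
    then have cz: "cnj z = inverse z" by (metis inverse_unique)
    have "z powi (- int (n + k + 1)) = cnj z ^ (n + k + 1)" for k
      unfolding power_int_minus power_int_of_nat cz by (simp add: power_inverse)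
    then have eq: "- ((1 / w) ^ (k + 1)) * z powi (- int (n + k + 1)) = - (cnj z ^ n) * (cnj z / w) * (cnj z / w) ^ k" for k
      by (simp add: power_add power_divide field_simps \<open>w \<noteq> 0\<close>)
    have q: "cmod (cnj z / w) < 1" using that w by (simp add: norm_divide divide_less_eq)
    have "(\<Sum>k. - ((1 / w) ^ (k + 1)) * z powi (- int (n + k + 1))) = - (cnj z ^ n) * (cnj z / w) * (1 / (1 - cnj z / w))"
      by (simp only: eq suminf_mult[OF summable_geometric[OF q]] suminf_geometric[OF q])
    also have "\<dots> = cnj z ^ n / (1 - z * w)"
    proof -
      have "1 - z * w \<noteq> 0" using that w by (metis eq_iff_diff_eq_0 mult_1 norm_mult norm_one mem_sphere_0 space_circ less_irrefl)
      moreover have "z * w - 1 \<noteq> 0" using calculation by simp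
      moreover have "1 - cnj z / w = (z * w - 1) / (z * w)"
        using z \<open>w \<noteq> 0\<close> by (simp add: cz field_simps)
      ultimately show ?thesis using z \<open>w \<noteq> 0\<close> by (simp add: cz divide_simps)
    qed
    finally show ?thesis .
  qed
  ultimately show ?thesis
    using False Bochner_Integration.integral_cong[OF refl] by (metis (no_types, lifting))
qed

text \<open>Up to the factor \<open>1 - (cmod w)\<^sup>2\<close> the integrand is the Poisson
  kernel, the real part of a function whose mean \<open>integral_circ_kernel\<close> gives at
  \<open>n = 0\<close>. That factor and the mean are both negative for \<open>cmod w > 1\<close>,
  whence the absolute value.\<close>

lemma nn_integral_circ_kernel:
  fixes w :: complex
  assumes w: "cmod w \<noteq> 1"
  shows "(\<integral>\<^sup>+z. ennreal ((cmod (1 / (1 - z * w)))\<^sup>2) \<partial>circ) = ennreal (2*pi / \<bar>1 - (cmod w)\<^sup>2\<bar>)"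
proof -
  define f where "f z = (cmod (1 / (1 - z * w)))\<^sup>2" for z
  have [measurable]: "f \<in> borel_measurable circ" "(\<lambda>z. 1 / (1 - z * w)) \<in> borel_measurable circ"
    unfolding f_def by measurable
  have lb: "\<bar>1 - cmod w\<bar> \<le> cmod (1 - z * w)" if "z \<in> space circ" for z
    using norm_triangle_ineq3[of 1 "z * w"] that by (simp add: norm_mult)
  have ub: "cmod (1 / (1 - z * w)) \<le> 1 / \<bar>1 - cmod w\<bar>" if "z \<in> space circ" for z
    using lb[OF that] w by (simp add: norm_divide frac_le)
  have i: "integrable circ (\<lambda>z. 1 / (1 - z * w))"
    by (rule circ.integrable_const_bound[where B = "1 / \<bar>1 - cmod w\<bar>"]) (use ub in auto)
  have fi: "integrable circ f"
    by (rule circ.integrable_const_bound[where B = "(1 / \<bar>1 - cmod w\<bar>)\<^sup>2"])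
      (use ub in \<open>auto simp: f_def intro!: power_mono\<close>)
  have poisson: "(1 - (cmod w)\<^sup>2) * f z = Re (2 * (1 / (1 - z * w)) - 1)" if "z \<in> space circ" for z
  proof -
    let ?q = "z * w"
    have n: "1 - ?q \<noteq> 0" using lb[OF that] w by auto
    have q: "(cmod w)\<^sup>2 = (cmod ?q)\<^sup>2" using that by (simp add: norm_mult)
    have d: "(cmod (1 - ?q))\<^sup>2 \<noteq> 0" using n by simp
    have "Re (1 / (1 - ?q)) = (1 - Re ?q) / (cmod (1 - ?q))\<^sup>2"
      by (subst Re_divide) (simp add: cmod_power2 del: times_complex.sel)
    moreover have "(cmod (1 - ?q))\<^sup>2 = 1 - 2 * Re ?q + (cmod ?q)\<^sup>2"
      unfolding cmod_power2 by (simp add: power2_eq_square algebra_simps del: times_complex.sel)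
    moreover have "Re (2 * (1 / (1 - ?q)) - 1) = 2 * Re (1 / (1 - ?q)) - 1"
      using Re_complex_of_real by (metis minus_complex.sel(1) mult_2 one_complex.sel(1) plus_complex.sel(1))
    moreover have "f z = 1 / (cmod (1 - ?q))\<^sup>2" by (simp add: f_def norm_divide power_divide)
    moreover have "(1 - Q) * (1 / D) = 2 * ((1 - P) / D) - 1" if "D \<noteq> 0" "D = 1 - 2 * P + Q" for D P Q :: real
      using that by (simp add: field_simps)
    ultimately show ?thesis
      unfolding q using d by (metis (no_types))
  qed
  have "(1 - (cmod w)\<^sup>2) * (LINT z|circ. f z) = (LINT z|circ. (1 - (cmod w)\<^sup>2) * f z)"
    by (rule integral_mult_right_zero[symmetric])
  also have "\<dots> = (LINT z|circ. Re (2 * (1 / (1 - z * w)) - 1))"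
    by (rule Bochner_Integration.integral_cong[OF refl poisson])
  also have "\<dots> = Re (LINT z|circ. 2 * (1 / (1 - z * w)) - 1)"
    by (intro integral_Re Bochner_Integration.integrable_diff integrable_mult_right i) auto
  also have "(LINT z|circ. 2 * (1 / (1 - z * w)) - 1) = 2 * (LINT z|circ. 1 / (1 - z * w)) - (LINT z|circ. 1)"
    by (subst Bochner_Integration.integral_diff[OF integrable_mult_right[OF i]])
      (simp_all only: circ.integrable_const integral_mult_right_zero)
  also have "\<dots> = (if cmod w < 1 then 2*pi else -2*pi)"
    using integral_circ_kernel[OF w, of 0] integral_circ_powi[of 0] by auto
  finally have I: "(1 - (cmod w)\<^sup>2) * (LINT z|circ. f z) = (if cmod w < 1 then 2*pi else -2*pi)"
    by (simp split: if_splits)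
  have "(LINT z|circ. f z) = 2*pi / \<bar>1 - (cmod w)\<^sup>2\<bar>"
  proof (cases "cmod w < 1")
    case True
    then have "0 < 1 - (cmod w)\<^sup>2" by (simp add: abs_square_less_1)
    then show ?thesis using I True by (simp add: field_simps)
  next
    case False
    then have "1 - (cmod w)\<^sup>2 < 0" using w by (simp add: one_less_power)
    then show ?thesis using I False by (simp add: field_simps)
  qed
  moreover have "(\<integral>\<^sup>+z. ennreal (f z) \<partial>circ) = ennreal (LINT z|circ. f z)"
    by (rule nn_integral_eq_integral[OF fi]) (simp add: f_def)
  ultimately show ?thesis by (simp add: f_def)
qed

section \<open>Weighted square bound for the Cauchy potential\<close>

lemma nn_integral_inv_sqrt_finite:
  "(\<integral>\<^sup>+t. ennreal (indicator {-R..R} t * \<bar>t\<bar> powr (-1/2)) \<partial>lborel) < \<infinity>"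
proof (cases "R \<ge> 0")
  case True
  let ?f = "\<lambda>t :: real. ennreal (indicator {0..R} t * t powr (-1/2))"
  have I: "(\<integral>\<^sup>+t. ?f t \<partial>lborel) = ennreal (R powr (-1/2 + 1) / (-1/2 + 1))"
    using nn_integral_has_integral_lebesgue[OF _ has_integral_powr_from_0[of "-1/2" R]] True by simp
  have "(\<integral>\<^sup>+t. ennreal (indicator {-R..R} t * \<bar>t\<bar> powr (-1/2)) \<partial>lborel) \<le> (\<integral>\<^sup>+t. ?f t + ?f (- t) \<partial>lborel)"
    by (intro nn_integral_mono) (auto simp: indicator_def)
  also have "\<dots> = (\<integral>\<^sup>+t. ?f t \<partial>lborel) + (\<integral>\<^sup>+t. ?f (- t) \<partial>lborel)"
    by (rule nn_integral_add) measurable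
  also have "(\<integral>\<^sup>+t. ?f (- t) \<partial>lborel) = (\<integral>\<^sup>+t. ?f t \<partial>lborel)"
    by (subst (2) nn_integral_real_affine[where c = "-1" and t = 0]) auto
  also have "(\<integral>\<^sup>+t. ?f t \<partial>lborel) + (\<integral>\<^sup>+t. ?f t \<partial>lborel) < \<infinity>"
    unfolding I by simp
  finally show ?thesis .
qed simp

definition inv_sqrt_mass :: "real \<Rightarrow> ennreal" where
  "inv_sqrt_mass R = (\<integral>\<^sup>+t. ennreal (indicator {-R..R} t * \<bar>t\<bar> powr (-1/2)) \<partial>lborel)"

text \<open>Shifting by \<open>s\<close> moves \<open>{0..R}\<close> into \<open>{-R..R}\<close>, so
  the bound is uniform in \<open>s\<close>.\<close>

lemma nn_integral_inv_sqrt_le: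
  assumes "s \<in> {0..R}"
  shows "(\<integral>\<^sup>+s'. ennreal (indicator {0..R} s' * \<bar>s - s'\<bar> powr (-1/2)) \<partial>lborel) \<le> inv_sqrt_mass R"
proof -
  have "(\<integral>\<^sup>+s'. ennreal (indicator {0..R} s' * \<bar>s - s'\<bar> powr (-1/2)) \<partial>lborel)
      = (\<integral>\<^sup>+t. ennreal (indicator {0..R} (s + t) * \<bar>t\<bar> powr (-1/2)) \<partial>lborel)"
    by (subst nn_integral_real_affine[where c = 1 and t = s]) auto
  also have "\<dots> \<le> inv_sqrt_mass R"
    unfolding inv_sqrt_mass_def
    by (intro nn_integral_mono ennreal_leI) (use assms in \<open>auto simp: indicator_def\<close>)
  finally show ?thesis .
qed

text \<open>For unit \<open>snd y\<close> this is the kernel 1 / (1 - zeta / zeta') of the overview.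
  Where the denominator vanishes the value is 0; for fixed \<open>x\<close> this happens on the
  circle only if \<open>fst y = fst x\<close>, a null set.\<close>

definition cauchy_kernel :: "real \<times> complex \<Rightarrow> real \<times> complex \<Rightarrow> complex" where
  "cauchy_kernel x y = 1 / (1 - disk_point x * inv_point y)"

lemma cauchy_kernel_measurable [measurable]: "(\<lambda>(x, y). cauchy_kernel x y) \<in> borel_measurable (cyl \<Otimes>\<^sub>M cyl)"
  unfolding cauchy_kernel_def by measurable

text \<open>Used with \<open>t = s' - s\<close>, it bounds the Poisson denominator from below by a
  multiple of the distance in time. It comes from exp a >= 1 + a; negative \<open>t\<close> is
  reduced to positive by the factor \<open>exp (2 * t)\<close>.\<close>

lemma one_minus_exp_ge:
  fixes t R :: real
  assumes "\<bar>t\<bar> \<le> R"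
  shows "2 * \<bar>t\<bar> * exp (- 2 * R) \<le> \<bar>1 - exp (2 * t)\<bar>"
proof (cases "t \<ge> 0")
  case True
  have "2 * t * exp (- 2 * R) \<le> 2 * t"
    using True assms by (intro mult_left_le) auto
  also have "2 * t \<le> exp (2 * t) - 1" using exp_ge_add_one_self[of "2 * t"] by linarith
  finally show ?thesis using True by simp
next
  case False
  have "2 * (- t) * exp (- 2 * R) \<le> (exp (2 * (- t)) - 1) * exp (2 * t)"
    using False assms exp_ge_add_one_self[of "2 * (- t)"] by (intro mult_mono) auto
  also have "\<dots> = 1 - exp (2 * t)" by (simp add: algebra_simps exp_minus_inverse exp_add[symmetric])
  finally show ?thesis using False by simp
qed

text \<open>The weight \<open>\<bar>s - s'\<bar> powr (1/2)\<close> leaves an integrable singularity, since the mean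
  of the squared cauchy_kernel over the circle \<open>{s'} \<times> circ\<close> has size \<open>1 / \<bar>s - s'\<bar>\<close>.\<close>

lemma nn_integral_cauchy_kernel_le:
  assumes x: "fst x \<in> {0..R}" "cmod (snd x) = 1"
  shows "(\<integral>\<^sup>+y. ennreal (indicator {0..R} (fst y) * \<bar>fst x - fst y\<bar> powr (1/2) * (cmod (cauchy_kernel x y))\<^sup>2) \<partial>cyl)
    \<le> ennreal (pi * exp (2 * R)) * inv_sqrt_mass R"
proof -
  obtain s z where sz: "x = (s, z)" by (cases x)
  have [measurable]: "cauchy_kernel x \<in> borel_measurable cyl" unfolding cauchy_kernel_def by measurable
  have "(\<integral>\<^sup>+y. ennreal (indicator {0..R} (fst y) * \<bar>s - fst y\<bar> powr (1/2) * (cmod (cauchy_kernel x y))\<^sup>2) \<partial>cyl)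
    = (\<integral>\<^sup>+s'. \<integral>\<^sup>+z'. ennreal (indicator {0..R} s' * \<bar>s - s'\<bar> powr (1/2) * (cmod (cauchy_kernel x (s', z')))\<^sup>2) \<partial>circ \<partial>lborel)"
    by (subst circ.nn_integral_fst[symmetric]) (auto simp: case_prod_beta)
  also have "\<dots> = (\<integral>\<^sup>+s'. ennreal (indicator {0..R} s' * \<bar>s - s'\<bar> powr (1/2)) * (\<integral>\<^sup>+z'. ennreal ((cmod (cauchy_kernel x (s', z')))\<^sup>2) \<partial>circ) \<partial>lborel)"
    by (subst nn_integral_cmult[symmetric]) (auto simp: ennreal_mult')
  also have "\<dots> \<le> (\<integral>\<^sup>+s'. ennreal (pi * exp (2 * R)) * ennreal (indicator {0..R} s' * \<bar>s - s'\<bar> powr (-1/2)) \<partial>lborel)"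
  proof (rule nn_integral_mono)
    fix s'
    show "ennreal (indicator {0..R} s' * \<bar>s - s'\<bar> powr (1/2)) * (\<integral>\<^sup>+z'. ennreal ((cmod (cauchy_kernel x (s', z')))\<^sup>2) \<partial>circ)
      \<le> ennreal (pi * exp (2 * R)) * ennreal (indicator {0..R} s' * \<bar>s - s'\<bar> powr (-1/2))"
    proof (cases "s' \<in> {0..R} \<and> s' \<noteq> s")
      case True
      \<comment> \<open>Conjugating the denominator frees the integration variable \<open>z'\<close>
        from its \<open>cnj\<close> and gives the form \<open>1 - z' * w\<close>, without changing
        the modulus.\<close>
      define w where "w = cnj (disk_point x) * exp s'"
      have cw: "cmod w = exp (s' - s)"
        using x by (simp add: w_def disk_point_def sz norm_mult exp_diff exp_minus divide_inverse norm_inverse)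
      then have w: "cmod w \<noteq> 1" using True by simp
      have sq: "(cmod w)\<^sup>2 = exp (2 * (s' - s))" unfolding cw by (simp add: power2_eq_square exp_add[symmetric])
      have "cmod (cauchy_kernel x (s', z')) = cmod (1 / (1 - z' * w))" for z'
      proof -
        have "1 - z' * w = cnj (1 - disk_point x * inv_point (s', z'))"
          by (simp add: w_def inv_point_def)
        then show ?thesis unfolding cauchy_kernel_def norm_divide by (metis complex_mod_cnj)
      qed
      then have "(\<integral>\<^sup>+z'. ennreal ((cmod (cauchy_kernel x (s', z')))\<^sup>2) \<partial>circ) = ennreal (2*pi / \<bar>1 - (cmod w)\<^sup>2\<bar>)"
        using nn_integral_circ_kernel[OF w] by simp
      moreover have "\<bar>s - s'\<bar> powr (1/2) * (2*pi / \<bar>1 - (cmod w)\<^sup>2\<bar>) \<le> pi * exp (2 * R) * \<bar>s - s'\<bar> powr (-1/2)"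
      proof -
        have "2 * \<bar>s - s'\<bar> * exp (- 2 * R) \<le> \<bar>1 - (cmod w)\<^sup>2\<bar>"
          unfolding sq abs_minus_commute[of s s'] by (rule one_minus_exp_ge) (use True x sz in auto)
        moreover have "0 < 2 * \<bar>s - s'\<bar> * exp (- 2 * R)" using True by simp
        ultimately have "2*pi / \<bar>1 - (cmod w)\<^sup>2\<bar> \<le> 2*pi / (2 * \<bar>s - s'\<bar> * exp (- 2 * R))"
          by (intro divide_left_mono) (auto intro: mult_pos_pos)
        also have "\<dots> = pi * exp (2 * R) * (1 / \<bar>s - s'\<bar>)"
          by (simp add: exp_minus field_simps)
        finally have "\<bar>s - s'\<bar> powr (1/2) * (2*pi / \<bar>1 - (cmod w)\<^sup>2\<bar>)
            \<le> \<bar>s - s'\<bar> powr (1/2) * (pi * exp (2 * R) * (1 / \<bar>s - s'\<bar>))"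
          by (intro mult_left_mono) auto
        also have "\<dots> = pi * exp (2 * R) * (\<bar>s - s'\<bar> powr (1/2) * \<bar>s - s'\<bar> powr (-1))"
          by (simp add: powr_minus_divide)
        also have "\<bar>s - s'\<bar> powr (1/2) * \<bar>s - s'\<bar> powr (-1) = \<bar>s - s'\<bar> powr (-1/2)"
          by (subst powr_add[symmetric]) simp
        finally show ?thesis .
      qed
      ultimately show ?thesis
        using True by (simp add: ennreal_mult[symmetric])
    qed (auto simp: indicator_def)
  qed
  also have "\<dots> = ennreal (pi * exp (2 * R)) * (\<integral>\<^sup>+s'. ennreal (indicator {0..R} s' * \<bar>s - s'\<bar> powr (-1/2)) \<partial>lborel)"
    by (rule nn_integral_cmult) measurable
  also have "\<dots> \<le> ennreal (pi * exp (2 * R)) * inv_sqrt_mass R"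
    by (intro mult_left_mono nn_integral_inv_sqrt_le) (use x sz in auto)
  finally show ?thesis by (simp add: sz)
qed

text \<open>Valued in \<open>ennreal\<close>, so that it majorises the potential before any
  integrability is known.\<close>

definition abs_potential :: "(real \<times> complex \<Rightarrow> complex) \<Rightarrow> real \<times> complex \<Rightarrow> ennreal" where
  "abs_potential U x = (\<integral>\<^sup>+y. ennreal (cmod (U y * cauchy_kernel x y)) \<partial>cyl)"

lemma AE_cyl_fst_neq: "AE y in cyl. fst y \<noteq> s"
proof (rule cyl.AE_pair_measure)
  show "AE t in lborel. AE z in circ. fst (t, z) \<noteq> s"
    using AE_lborel_singleton[of s] by (rule eventually_mono) simp
qed measurable

lemma abs_potential_measurable [measurable]:
  assumes [measurable]: "U \<in> borel_measurable cyl"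
  shows "abs_potential U \<in> borel_measurable cyl"
  unfolding abs_potential_def by measurable

text \<open>A Schur type estimate: Cauchy-Schwarz with the weight
  \<open>\<bar>s - s'\<bar> powr (1/4)\<close> and its inverse leaves the integrable singularity
  \<open>\<bar>s - s'\<bar> powr (-1/2)\<close> both in the kernel factor and in the factor with
  \<open>U\<close>; the latter is then integrated over \<open>x\<close> first.\<close>

lemma nn_integral_abs_potential_finite:
  assumes U: "square_integrable cyl U" and U0: "\<And>p. fst p \<notin> {0..R} \<Longrightarrow> U p = 0"
  shows "(\<integral>\<^sup>+x. indicator {0..R} (fst x) * (abs_potential U x)\<^sup>2 \<partial>cyl) < \<infinity>"
proof -
  have [measurable]: "U \<in> borel_measurable cyl" using U by (simp add: square_integrable_def)
  define C where "C = ennreal (pi * exp (2 * R)) * inv_sqrt_mass R"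
  have mass: "inv_sqrt_mass R < \<infinity>"
    unfolding inv_sqrt_mass_def by (rule nn_integral_inv_sqrt_finite)
  define H where "H x y = ennreal ((cmod (U y))\<^sup>2 * \<bar>fst x - fst y\<bar> powr (-1/2))" for x y :: "real \<times> complex"
  have [measurable]: "(\<lambda>(x, y). H x y) \<in> borel_measurable (cyl \<Otimes>\<^sub>M cyl)"
    unfolding H_def by measurable
  have le: "(abs_potential U x)\<^sup>2 \<le> C * (\<integral>\<^sup>+y. H x y \<partial>cyl)"
    if x: "fst x \<in> {0..R}" "cmod (snd x) = 1" for x :: "real \<times> complex"
  proof -
    have [measurable]: "cauchy_kernel x \<in> borel_measurable cyl" unfolding cauchy_kernel_def by measurable
    have pw: "(a powr q)\<^sup>2 = a powr (2 * q)" for a q :: real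
      by (simp add: power2_eq_square powr_add[symmetric])
    let ?f = "\<lambda>y. ennreal (indicator {0..R} (fst y) * \<bar>fst x - fst y\<bar> powr (1/4) * cmod (cauchy_kernel x y))"
    let ?g = "\<lambda>y. ennreal (cmod (U y) * \<bar>fst x - fst y\<bar> powr (-1/4))"
    have "abs_potential U x = (\<integral>\<^sup>+y. ?f y * ?g y \<partial>cyl)"
      unfolding abs_potential_def
    \<comment> \<open>The weights multiply to 1 except at \<open>fst y = fst x\<close>, where
      \<open>0 powr\<close> makes both of them 0; this is a null set.\<close>
    proof (rule nn_integral_cong_AE, rule AE_mp[OF AE_cyl_fst_neq[of "fst x"]], intro AE_I2 impI)
      fix y :: "real \<times> complex" assume ne: "fst y \<noteq> fst x"
      then have p: "\<bar>fst x - fst y\<bar> powr (1/4) * \<bar>fst x - fst y\<bar> powr (-1/4) = 1"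
        by (simp add: powr_add[symmetric])
      have "indicator {0..R} (fst y) * \<bar>fst x - fst y\<bar> powr (1/4) * cmod (cauchy_kernel x y) * (cmod (U y) * \<bar>fst x - fst y\<bar> powr (-1/4))
          = (\<bar>fst x - fst y\<bar> powr (1/4) * \<bar>fst x - fst y\<bar> powr (-1/4)) * (indicator {0..R} (fst y) * cmod (U y)) * cmod (cauchy_kernel x y)"
        by (simp only: mult_ac)
      also have "\<dots> = cmod (U y * cauchy_kernel x y)"
        unfolding p using U0[of y] by (auto simp: indicator_def norm_mult)
      finally show "ennreal (cmod (U y * cauchy_kernel x y)) = ?f y * ?g y"
        by (simp add: ennreal_mult[symmetric])
    qed
    then have "(abs_potential U x)\<^sup>2 \<le> (\<integral>\<^sup>+y. (?f y)\<^sup>2 \<partial>cyl) * (\<integral>\<^sup>+y. (?g y)\<^sup>2 \<partial>cyl)"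
      by (simp only:) (rule Cauchy_Schwarz_nn_integral; measurable)
    also have "(\<lambda>y. (?g y)\<^sup>2) = H x"
      by (rule ext) (simp add: H_def ennreal_power power_mult_distrib pw)
    also have "(\<lambda>y. (?f y)\<^sup>2) = (\<lambda>y. ennreal (indicator {0..R} (fst y) * \<bar>fst x - fst y\<bar> powr (1/2) * (cmod (cauchy_kernel x y))\<^sup>2))"
      by (rule ext) (simp add: ennreal_power power_mult_distrib pw indicator_def)
    also have "(\<integral>\<^sup>+y. ennreal (indicator {0..R} (fst y) * \<bar>fst x - fst y\<bar> powr (1/2) * (cmod (cauchy_kernel x y))\<^sup>2) \<partial>cyl) * (\<integral>\<^sup>+y. H x y \<partial>cyl)
        \<le> C * (\<integral>\<^sup>+y. H x y \<partial>cyl)"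
      unfolding C_def by (intro mult_right_mono nn_integral_cauchy_kernel_le x) simp
    finally show ?thesis .
  qed
  have "(\<integral>\<^sup>+x. indicator {0..R} (fst x) * (abs_potential U x)\<^sup>2 \<partial>cyl)
      \<le> (\<integral>\<^sup>+x. C * (\<integral>\<^sup>+y. indicator {0..R} (fst x) * H x y \<partial>cyl) \<partial>cyl)"
    using le by (intro nn_integral_mono) (auto simp: indicator_def space_pair_measure)
  also have "\<dots> = C * (\<integral>\<^sup>+x. \<integral>\<^sup>+y. indicator {0..R} (fst x) * H x y \<partial>cyl \<partial>cyl)"
    by (rule nn_integral_cmult) measurable
  also have "(\<integral>\<^sup>+x. \<integral>\<^sup>+y. indicator {0..R} (fst x) * H x y \<partial>cyl \<partial>cyl) = (\<integral>\<^sup>+y. \<integral>\<^sup>+x. indicator {0..R} (fst x) * H x y \<partial>cyl \<partial>cyl)"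
  proof -
    interpret pair_sigma_finite cyl cyl ..
    show ?thesis by (rule Fubini'[symmetric]) measurable
  qed
  also have "\<dots> \<le> (\<integral>\<^sup>+y. ennreal ((cmod (U y))\<^sup>2) * (inv_sqrt_mass R * emeasure circ (space circ)) \<partial>cyl)"
  proof (rule nn_integral_mono)
    fix y :: "real \<times> complex"
    show "(\<integral>\<^sup>+x. indicator {0..R} (fst x) * H x y \<partial>cyl) \<le> ennreal ((cmod (U y))\<^sup>2) * (inv_sqrt_mass R * emeasure circ (space circ))"
    proof (cases "fst y \<in> {0..R}")
      case True
      have "(\<integral>\<^sup>+x. indicator {0..R} (fst x) * H x y \<partial>cyl)
          = (\<integral>\<^sup>+x. ennreal ((cmod (U y))\<^sup>2) * ennreal (indicator {0..R} (fst x) * \<bar>fst y - fst x\<bar> powr (-1/2)) \<partial>cyl)"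
        by (intro nn_integral_cong) (auto simp: H_def indicator_def ennreal_mult abs_minus_commute)
      also have "\<dots> = ennreal ((cmod (U y))\<^sup>2) * (\<integral>\<^sup>+x. ennreal (indicator {0..R} (fst x) * \<bar>fst y - fst x\<bar> powr (-1/2)) \<partial>cyl)"
        by (rule nn_integral_cmult) measurable
      also have "(\<integral>\<^sup>+x. ennreal (indicator {0..R} (fst x) * \<bar>fst y - fst x\<bar> powr (-1/2)) \<partial>cyl)
          = (\<integral>\<^sup>+s. \<integral>\<^sup>+z. ennreal (indicator {0..R} s * \<bar>fst y - s\<bar> powr (-1/2)) \<partial>circ \<partial>lborel)"
        by (subst circ.nn_integral_fst[symmetric]) auto
      also have "\<dots> = (\<integral>\<^sup>+s. ennreal (indicator {0..R} s * \<bar>fst y - s\<bar> powr (-1/2)) \<partial>lborel) * emeasure circ (space circ)"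
        by (simp add: nn_integral_multc del: space_circ)
      also have "ennreal ((cmod (U y))\<^sup>2) * \<dots> \<le> ennreal ((cmod (U y))\<^sup>2) * (inv_sqrt_mass R * emeasure circ (space circ))"
        by (intro mult_left_mono mult_right_mono nn_integral_inv_sqrt_le True) auto
      finally show ?thesis .
    qed (simp add: H_def U0)
  qed
  also have "\<dots> = (\<integral>\<^sup>+y. ennreal ((cmod (U y))\<^sup>2) \<partial>cyl) * (inv_sqrt_mass R * emeasure circ (space circ))"
    by (rule nn_integral_multc) measurable
  finally have "(\<integral>\<^sup>+x. indicator {0..R} (fst x) * (abs_potential U x)\<^sup>2 \<partial>cyl)
      \<le> C * ((\<integral>\<^sup>+y. ennreal ((cmod (U y))\<^sup>2) \<partial>cyl) * (inv_sqrt_mass R * emeasure circ (space circ)))"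
    by (simp add: mult_left_mono)
  also have "\<dots> < \<infinity>"
    using U mass unfolding C_def square_integrable_def integrable_iff_bounded
    by (simp add: ennreal_mult_less_top ennreal_mult_eq_top_iff circ.emeasure_finite less_top[symmetric] del: space_circ)
  finally show ?thesis .
qed

section \<open>Analytic continuation\<close>

lemma disk_point_inv_point:
  assumes "cmod (snd p) = 1"
  shows "disk_point p * inv_point p = 1"
proof -
  have "snd p * cnj (snd p) = 1" using assms by (simp add: complex_norm_square[symmetric])
  moreover have "complex_of_real (exp (- fst p)) * of_real (exp (fst p)) = 1"
    by (simp add: exp_minus flip: of_real_mult)
  moreover have "disk_point p * inv_point p =
      (complex_of_real (exp (- fst p)) * of_real (exp (fst p))) * (snd p * cnj (snd p))"
    unfolding disk_point_def inv_point_def by (simp only: mult_ac)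
  ultimately show ?thesis by simp
qed

text \<open>This is \<open>2*pi\<close> times the integral term of G. Where the integrand is not
  integrable the value is the default 0, which still obeys the bound by
  \<open>abs_potential\<close>.\<close>

definition potential :: "(real \<times> complex \<Rightarrow> complex) \<Rightarrow> complex \<Rightarrow> complex" where
  "potential U \<zeta> = (LINT y|cyl. U y / (1 - \<zeta> * inv_point y))"

text \<open>With h = zeta - zeta0 and i = \<open>inv_point y\<close>, the denominator factors as (1
  - zeta0 i)(1 - h i / (1 - zeta0 i)), and since 1 - zeta0 i = (\<open>disk_point y\<close> - zeta0)
  i, the inner ratio is at most |h| / d. The result serves twice: for holomorphy near any centre off
  the sources, and at centre 0, where the coefficients are the moments.\<close>

lemma potential_power_series:
  assumes U: "square_integrable cyl U" and U0: "\<And>p. fst p \<notin> {0..R} \<Longrightarrow> U p = 0"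
    and d: "\<And>p. cmod (snd p) = 1 \<Longrightarrow> U p \<noteq> 0 \<Longrightarrow> d \<le> cmod (disk_point p - \<zeta>0)"
    and \<zeta>: "cmod (\<zeta> - \<zeta>0) < d"
  shows "(\<lambda>k. (LINT y|cyl. U y * (inv_point y ^ k / (1 - \<zeta>0 * inv_point y) ^ Suc k)) * (\<zeta> - \<zeta>0) ^ k)
    sums potential U \<zeta>"
proof -
  have [measurable]: "U \<in> borel_measurable cyl" using U by (simp add: square_integrable_def)
  have d0: "d > 0" using \<zeta> norm_ge_zero[of "\<zeta> - \<zeta>0"] by linarith
  define h where "h = \<zeta> - \<zeta>0"
  define q where "q = cmod h / d"
  have q: "0 \<le> q" "q < 1" using \<zeta> d0 by (auto simp: q_def h_def)
  define g where "g k y = U y * (inv_point y ^ k / (1 - \<zeta>0 * inv_point y) ^ Suc k) * h ^ k" for k y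
  have iU: "integrable cyl U"
    using square_integrable_times_bounded[OF U U0, where g = "\<lambda>_. 1" and B = 1] by simp
  have bounds: "d * cmod (inv_point y) \<le> cmod (1 - \<zeta>0 * inv_point y)" "1 \<le> cmod (inv_point y)"
    if y: "y \<in> space cyl" "U y \<noteq> 0" for y
  proof -
    have y1: "cmod (snd y) = 1" using y by (auto simp: space_pair_measure)
    have "1 - \<zeta>0 * inv_point y = (disk_point y - \<zeta>0) * inv_point y"
      using disk_point_inv_point[OF y1] by (simp add: algebra_simps)
    then show "d * cmod (inv_point y) \<le> cmod (1 - \<zeta>0 * inv_point y)"
      using d[OF y1 y(2)] by (simp add: norm_mult mult_right_mono)
    have "0 \<le> fst y" using U0[of y] y(2) by auto
    then show "1 \<le> cmod (inv_point y)"
      using y1 by (simp add: inv_point_def norm_mult)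
  qed
  have ratio: "cmod (h * inv_point y / (1 - \<zeta>0 * inv_point y)) \<le> q" "cmod (1 / (1 - \<zeta>0 * inv_point y)) \<le> 1 / d"
    "1 - \<zeta>0 * inv_point y \<noteq> 0"
    if y: "y \<in> space cyl" "U y \<noteq> 0" for y
  proof -
    note b = bounds[OF y]
    have pos: "0 < d * cmod (inv_point y)" using d0 b(2) by (intro mult_pos_pos) linarith+
    then show "1 - \<zeta>0 * inv_point y \<noteq> 0" using b(1) by auto
    have "cmod (h * inv_point y / (1 - \<zeta>0 * inv_point y)) \<le> cmod h * cmod (inv_point y) / (d * cmod (inv_point y))"
      unfolding norm_divide norm_mult by (rule divide_left_mono[OF b(1)]) (use pos b(1) in \<open>auto intro!: mult_pos_pos\<close>)
    also have "\<dots> = q" using b(2) d0 by (auto simp: q_def)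
    finally show "cmod (h * inv_point y / (1 - \<zeta>0 * inv_point y)) \<le> q" .
    have "d \<le> d * cmod (inv_point y)" using d0 b(2) by (simp add: mult_le_cancel_left1)
    then have "d \<le> cmod (1 - \<zeta>0 * inv_point y)" using b(1) by linarith
    then show "cmod (1 / (1 - \<zeta>0 * inv_point y)) \<le> 1 / d"
      using d0 by (simp add: norm_divide frac_le)
  qed
  have g_eq: "g k y = U y * (1 / (1 - \<zeta>0 * inv_point y)) * (h * inv_point y / (1 - \<zeta>0 * inv_point y)) ^ k" for k y
    unfolding g_def by (simp add: power_divide power_mult_distrib)
  have g_le: "norm (g k y) \<le> q ^ k / d * cmod (U y)" if y: "y \<in> space cyl" for k y
  proof (cases "U y = 0")
    case False
    have "norm (g k y) = cmod (U y) * cmod (1 / (1 - \<zeta>0 * inv_point y)) * cmod (h * inv_point y / (1 - \<zeta>0 * inv_point y)) ^ k"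
      unfolding g_eq norm_mult norm_power ..
    also have "\<dots> \<le> cmod (U y) * (1 / d) * q ^ k"
      by (intro mult_mono power_mono ratio y False) (use d0 q in auto)
    finally show ?thesis by (simp add: mult_ac)
  qed (simp add: g_def)
  have [measurable]: "g k \<in> borel_measurable cyl" for k
    unfolding g_def by measurable
  have ig: "integrable cyl (g k)" for k
  proof (rule Bochner_Integration.integrable_bound)
    show "integrable cyl (\<lambda>y. q ^ k / d * cmod (U y))"
      using iU by (intro integrable_mult_right integrable_norm)
    show "AE y in cyl. norm (g k y) \<le> norm (q ^ k / d * cmod (U y))"
      using g_le q d0 by (intro AE_I2) (auto simp: abs_mult)
  qed simp
  have gsum: "(\<lambda>k. g k y) sums (U y / (1 - \<zeta> * inv_point y))" "summable (\<lambda>k. norm (g k y))"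
    if y: "y \<in> space cyl" for y
  proof -
    show "summable (\<lambda>k. norm (g k y))"
      by (rule summable_comparison_test'[where g = "\<lambda>k. q ^ k * (1 / d * cmod (U y))" and N = 0])
        (use g_le[OF y] q in \<open>auto intro!: summable_mult2 summable_geometric\<close>)
    show "(\<lambda>k. g k y) sums (U y / (1 - \<zeta> * inv_point y))"
    proof (cases "U y = 0")
      case False
      note r = ratio[OF y False]
      let ?e = "1 - \<zeta>0 * inv_point y"
      let ?r = "h * inv_point y / ?e"
      have r1: "norm ?r < 1" using r(1) q(2) by linarith
      have "(\<lambda>k. U y * (1 / ?e) * ?r ^ k) sums (U y * (1 / ?e) * (1 / (1 - ?r)))"
        by (intro sums_mult geometric_sums r1)
      moreover have "?e * (1 - ?r) = ?e - h * inv_point y"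
        using r(3) by (simp add: right_diff_distrib)
      then have "?e * (1 - ?r) = 1 - \<zeta> * inv_point y"
        by (simp add: h_def algebra_simps)
      ultimately show ?thesis
        unfolding g_eq by (simp add: mult.assoc)
    qed (simp add: g_def)
  qed
  have "(\<lambda>k. LINT y|cyl. g k y) sums (LINT y|cyl. (\<Sum>k. g k y))"
  proof (rule sums_integral[OF ig])
    show "AE y in cyl. summable (\<lambda>k. norm (g k y))"
      by (rule AE_I2) (rule gsum(2))
    show "summable (\<lambda>k. LINT y|cyl. norm (g k y))"
    proof (rule summable_comparison_test'[where N = 0])
      show "summable (\<lambda>k. q ^ k * (1 / d * (LINT y|cyl. cmod (U y))))"
        using q by (intro summable_mult2 summable_geometric) auto
      fix k
      have "(LINT y|cyl. norm (g k y)) \<le> (LINT y|cyl. q ^ k / d * cmod (U y))"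
        using ig iU g_le by (intro integral_mono integrable_mult_right integrable_norm) auto
      then show "norm (LINT y|cyl. norm (g k y)) \<le> q ^ k * (1 / d * (LINT y|cyl. cmod (U y)))"
        by simp
    qed
  qed
  also have "(LINT y|cyl. (\<Sum>k. g k y)) = potential U \<zeta>"
    unfolding potential_def
    by (rule Bochner_Integration.integral_cong[OF refl]) (use gsum(1) sums_unique in force)
  finally show ?thesis
    unfolding g_def h_def integral_mult_left_zero .
qed

text \<open>This is what keeps the truncated control on the arc: the correction term of the cutoff
  vanishes over points outside \<open>C\<close>. Boundedness of \<open>c\<close> makes the power
  series holomorphic in the whole unit disk.\<close>

lemma potential_eq_0:
  assumes U: "square_integrable cyl U" and U0: "\<And>p. fst p \<notin> {0..R} \<or> snd p \<notin> C \<Longrightarrow> U p = 0"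
    and C: "closed C" "C \<subseteq> sphere 0 1"
    and B: "\<And>n. cmod (c n) \<le> B"
    and mom: "\<And>n. c n + (LINT p|cyl. U p * inv_point p ^ n) = 0"
    and p: "fst p > 0" "cmod (snd p) = 1" "snd p \<notin> C"
  shows "(\<Sum>n. c n * disk_point p ^ n) + potential U (disk_point p) = 0"
proof -
  have U0': "fst p \<notin> {0..R} \<Longrightarrow> U p = 0" for p using U0 by blast
  define F where "F \<zeta> = (\<Sum>n. c n * \<zeta> ^ n)" for \<zeta>
  define K where "K = disk_point ` ({0..R} \<times> C)"
  have K: "disk_point p \<in> K" if "U p \<noteq> 0" for p
    using U0[of p] that unfolding K_def by (intro imageI) (metis mem_Times_iff)
  have "compact C"
    using C compact_eq_bounded_closed bounded_subset[OF bounded_sphere] by blast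
  then have "compact K"
    unfolding K_def disk_point_def by (intro compact_continuous_image compact_Times continuous_intros) auto
  then have clK: "closed K" by (rule compact_imp_closed)
  define \<Omega> where "\<Omega> = ball 0 1 - K"
  have op: "open \<Omega>" unfolding \<Omega>_def using clK by (intro open_Diff) auto
  have Kd: "exp (- R) \<le> cmod \<zeta>" if "\<zeta> \<in> K" for \<zeta>
    using that C(2) by (auto simp: K_def disk_point_def norm_mult)
  have "starlike \<Omega>"
  proof (unfold starlike_def, intro bexI[of _ 0] ballI subsetI)
    show z: "0 \<in> \<Omega>" using Kd[of 0] by (auto simp: \<Omega>_def)
    fix \<zeta> \<xi> assume \<zeta>: "\<zeta> \<in> \<Omega>" and "\<xi> \<in> closed_segment 0 \<zeta>"
    then obtain t where t: "0 \<le> t" "t \<le> 1" "\<xi> = t *\<^sub>R \<zeta>" by (auto simp: in_segment)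
    have "cmod \<xi> \<le> cmod \<zeta>" using t by (simp add: mult_left_le_one_le)
    moreover have "\<xi> \<notin> K"
    proof
      assume \<xi>: "\<xi> \<in> K"
      then obtain s z where sz: "s \<in> {0..R}" "z \<in> C" "\<xi> = of_real (exp (- s)) * z"
        by (auto simp: K_def disk_point_def)
      have cz: "cmod z = 1" using sz(2) C(2) by auto
      have "\<xi> \<noteq> 0" using Kd[OF \<xi>] by auto
      then have tp: "t > 0" using t by (cases "t = 0") auto
      \<comment> \<open>Stretching by \<open>1 / t\<close> moves a point of \<open>K\<close> along
        its ray from depth \<open>s\<close> to \<open>s + ln t\<close>, which is at most
        \<open>s\<close>. The stretched point still has modulus below 1, so the new depth is
        positive and the point lies in \<open>K\<close>, which reaches up to depth 0.\<close>
      define s' where "s' = s + ln t"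
      have e: "exp (- s') = exp (- s) / t" using tp by (simp add: s'_def exp_diff exp_minus divide_inverse exp_add)
      have \<zeta>s: "\<zeta> = of_real (exp (- s')) * z"
        using t(3) sz(3) tp unfolding e by (simp add: scaleR_conv_of_real field_simps)
      have "cmod \<zeta> < 1" using \<zeta> by (auto simp: \<Omega>_def)
      then have "s' > 0" unfolding \<zeta>s using cz by (simp add: norm_mult)
      moreover have "s' \<le> R" using sz(1) ln_le_zero_iff[OF tp] t(2) unfolding s'_def by simp
      ultimately have "\<zeta> \<in> K" unfolding K_def \<zeta>s using sz(2)
        by (intro image_eqI[of _ _ "(s', z)"]) (auto simp: disk_point_def)
      then show False using \<zeta> by (simp add: \<Omega>_def)
    qed
    ultimately show "\<xi> \<in> \<Omega>" using \<zeta> by (auto simp: \<Omega>_def)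
  qed
  then have conn: "connected \<Omega>" by (rule starlike_imp_connected)
  have Fsums: "(\<lambda>n. c n * \<zeta> ^ n) sums F \<zeta>" if "cmod \<zeta> < 1" for \<zeta>
  proof -
    have "summable (\<lambda>n. c n * \<zeta> ^ n)"
      by (rule summable_comparison_test'[where g = "\<lambda>n. B * cmod \<zeta> ^ n" and N = 0])
        (use that B in \<open>auto simp: norm_mult norm_power intro!: summable_mult summable_geometric mult_right_mono\<close>)
    then show ?thesis unfolding F_def by (rule summable_sums)
  qed
  have "F holomorphic_on ball 0 1"
    by (rule power_series_holomorphic[where a = c]) (use Fsums in auto)
  then have Fhol: "F holomorphic_on \<Omega>" by (rule holomorphic_on_subset) (auto simp: \<Omega>_def)
  have Phol: "potential U holomorphic_on \<Omega>"
  proof (rule holomorphic_onI)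
    fix \<zeta>0 assume "\<zeta>0 \<in> \<Omega>"
    then have "\<zeta>0 \<notin> K" by (simp add: \<Omega>_def)
    then obtain d where d: "d > 0" "\<forall>\<xi>\<in>K. d \<le> dist \<zeta>0 \<xi>"
      using separate_point_closed[OF clK] by blast
    have "potential U holomorphic_on ball \<zeta>0 d"
    proof (rule power_series_holomorphic)
      fix \<zeta> assume "\<zeta> \<in> ball \<zeta>0 d"
      then have z: "cmod (\<zeta> - \<zeta>0) < d" by (simp add: dist_norm norm_minus_commute)
      have "d \<le> cmod (disk_point p - \<zeta>0)" if "U p \<noteq> 0" for p
        using d(2) K[OF that] by (auto simp: dist_norm norm_minus_commute)
      then show "(\<lambda>k. (LINT y|cyl. U y * (inv_point y ^ k / (1 - \<zeta>0 * inv_point y) ^ Suc k)) * (\<zeta> - \<zeta>0) ^ k)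
          sums potential U \<zeta>"
        by (intro potential_power_series[OF U U0' _ z])
    qed
    then have "potential U field_differentiable at \<zeta>0"
      using d(1) by (auto intro: holomorphic_on_imp_differentiable_at)
    then show "potential U field_differentiable at \<zeta>0 within \<Omega>"
      by (rule field_differentiable_at_within)
  qed
  \<comment> \<open>The radius \<open>exp (- R)\<close> is a lower bound for the distance of
    \<open>K\<close> from 0, so both terms expand at 0 and \<open>mom\<close> cancels them
    coefficient by coefficient.\<close>
  have near: "F \<zeta> + potential U \<zeta> = 0" if \<zeta>: "\<zeta> \<in> ball 0 1 \<inter> ball 0 (exp (- R))" for \<zeta>
  proof -
    have "(\<lambda>k. (LINT y|cyl. U y * (inv_point y ^ k / (1 - 0 * inv_point y) ^ Suc k)) * (\<zeta> - 0) ^ k)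
          sums potential U \<zeta>"
      by (rule potential_power_series[OF U U0', where d = "exp (- R)"]) (use K Kd \<zeta> in auto)
    then have "(\<lambda>k. (LINT y|cyl. U y * inv_point y ^ k) * \<zeta> ^ k) sums potential U \<zeta>" by simp
    from sums_add[OF Fsums this] \<zeta> have "(\<lambda>k. (c k + (LINT y|cyl. U y * inv_point y ^ k)) * \<zeta> ^ k) sums (F \<zeta> + potential U \<zeta>)"
      by (simp add: distrib_right)
    then have "(\<lambda>k. 0) sums (F \<zeta> + potential U \<zeta>)" by (simp add: mom)
    from sums_unique2[OF this sums_zero] show ?thesis .
  qed
  have "disk_point p \<in> \<Omega>"
  proof -
    have "disk_point p \<notin> K"
    proof
      assume "disk_point p \<in> K"
      then obtain y where y: "y \<in> {0..R} \<times> C" "disk_point p = disk_point y"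
        unfolding K_def by (rule imageE)
      then have "snd y \<in> C" "cmod (snd y) = 1" using C(2) by auto
      have "cmod (disk_point p) = exp (- fst p)" "cmod (disk_point y) = exp (- fst y)"
        using p(2) \<open>cmod (snd y) = 1\<close> by (simp_all add: disk_point_def norm_mult)
      then have "fst p = fst y" using y(2) by simp
      then have "snd p = snd y" using y(2) by (simp add: disk_point_def)
      then show False using \<open>snd y \<in> C\<close> p(3) by simp
    qed
    moreover have "cmod (disk_point p) < 1" using p by (simp add: disk_point_def norm_mult)
    ultimately show ?thesis by (simp add: \<Omega>_def)
  qed
  then have "F (disk_point p) + potential U (disk_point p) = 0"
  proof (rule analytic_continuation_open[where f = "\<lambda>\<zeta>. F \<zeta> + potential U \<zeta>" and g = "\<lambda>_. 0" and s = "ball 0 1 \<inter> ball 0 (exp (- R))", rotated -1])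
    show "ball 0 1 \<inter> ball 0 (exp (- R)) \<subseteq> \<Omega>"
      using Kd by (auto simp: \<Omega>_def not_le[symmetric] simp del: not_le)
    show "ball 0 1 \<inter> ball (0::complex) (exp (- R)) \<noteq> {}"
      by (rule ex_in_conv[THEN iffD1], rule exI[of _ 0]) simp
  qed (use op conn near Fhol Phol in \<open>auto intro!: holomorphic_intros\<close>)
  then show ?thesis by (simp add: F_def)
qed

section \<open>Truncating the control in time\<close>

lemma AE_circ_neq: "AE z in circ. z \<noteq> c"
proof -
  have "AE z in circ. Arg2pi z \<notin> {Arg2pi c}"
    by (rule AE_circ_Arg2pi) (rule finite_imp_null_set_lborel, simp)
  then show ?thesis by (rule eventually_mono) auto
qed

text \<open>Continuation needs the sources in a closed set, while controls must live on the open
  arc. The two differ by at most two endpoints, a null set.\<close>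

lemma open_strict_interval_closure:
  assumes "open_strict_interval \<omega>"
  obtains C where "closed C" "C \<subseteq> sphere 0 1" "\<omega> \<subseteq> C" "\<omega> \<in> sets circ" "AE z in circ. z \<in> C \<longrightarrow> z \<in> \<omega>"
proof -
  obtain a b where w: "\<omega> = cis ` {a<..<b}"
    using assms unfolding open_strict_interval_def by blast
  define C where "C = cis ` {a..b}"
  have cl: "closed C"
    unfolding C_def by (intro compact_imp_closed compact_continuous_image continuous_intros) auto
  have sub: "C \<subseteq> sphere 0 1" "\<omega> \<subseteq> C" unfolding C_def w by auto
  have D: "C - \<omega> \<subseteq> {cis a, cis b}"
  proof
    fix z assume z: "z \<in> C - \<omega>"
    then obtain x where x: "x \<in> {a..b}" "z = cis x" unfolding C_def by auto
    then have "x \<notin> {a<..<b}" using z unfolding w by auto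
    with x show "z \<in> {cis a, cis b}" by (cases "x = a") auto
  qed
  then have "finite (C - \<omega>)" by (rule finite_subset) simp
  then have "C - (C - \<omega>) \<in> sets borel"
    by (rule sets.Diff[OF borel_closed[OF cl] borel_closed[OF finite_imp_closed]])
  moreover have "C - (C - \<omega>) = \<omega>" using sub by auto
  ultimately have "\<omega> \<in> sets circ"
    using sub by (simp add: sets_restrict_space_iff)
  moreover have "AE z in circ. z \<in> C \<longrightarrow> z \<in> \<omega>"
    using AE_circ_neq[of "cis a"] AE_circ_neq[of "cis b"] by eventually_elim (use D in auto)
  ultimately show ?thesis using that cl sub by blast
qed

lemma power_series_summable:
  fixes c :: "nat \<Rightarrow> complex"
  assumes B: "\<And>n. cmod (c n) \<le> B" and \<zeta>: "cmod \<zeta> < 1"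
  shows "summable (\<lambda>n. c n * \<zeta> ^ n)" "cmod (\<Sum>n. c n * \<zeta> ^ n) \<le> B / (1 - cmod \<zeta>)"
proof -
  have le: "norm (c n * \<zeta> ^ n) \<le> B * cmod \<zeta> ^ n" for n
    unfolding norm_mult norm_power by (intro mult_right_mono B) auto
  have g: "(\<lambda>n. B * cmod \<zeta> ^ n) sums (B * (1 / (1 - cmod \<zeta>)))"
    by (intro sums_mult geometric_sums) (use \<zeta> in auto)
  have sn: "summable (\<lambda>n. norm (c n * \<zeta> ^ n))"
    by (rule summable_comparison_test'[OF sums_summable[OF g], where N = 0]) (use le in auto)
  then show "summable (\<lambda>n. c n * \<zeta> ^ n)" by (rule summable_norm_cancel)
  have "cmod (\<Sum>n. c n * \<zeta> ^ n) \<le> (\<Sum>n. norm (c n * \<zeta> ^ n))"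
    by (rule summable_norm[OF sn])
  also have "\<dots> \<le> (\<Sum>n. B * cmod \<zeta> ^ n)"
    by (rule suminf_le[OF le sn sums_summable[OF g]])
  also have "\<dots> = B / (1 - cmod \<zeta>)" using sums_unique[OF g] by simp
  finally show "cmod (\<Sum>n. c n * \<zeta> ^ n) \<le> B / (1 - cmod \<zeta>)" .
qed

text \<open>Cauchy's coefficient formula on the circle of radius \<open>exp (- s)\<close>. The power
  of \<open>exp s\<close> in \<open>inv_point\<close> undoes the scaling of the radius, so the value
  is independent of \<open>s\<close>.\<close>

lemma integral_circ_power_series:
  fixes c :: "nat \<Rightarrow> complex"
  assumes B: "\<And>n. cmod (c n) \<le> B" and s: "s > 0"
  shows "(LINT z|circ. (\<Sum>k. c k * disk_point (s, z) ^ k) * inv_point (s, z) ^ n) = 2*pi * c n"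
proof -
  define a where "a k = c k * of_real (exp (- s)) ^ k" for k
  have a_le: "cmod (a k) \<le> B * exp (- s) ^ k" for k
    unfolding a_def norm_mult norm_power by (simp add: B mult_right_mono)
  then have "(\<lambda>k. a k * (if int k - int n = 0 then 2*pi else 0)) sums (LINT z|circ. (\<Sum>k. a k * z powi (int k - int n)))"
    by (rule integral_circ_series) (use s in auto)
  moreover have "(\<lambda>k. a k * (if int k - int n = 0 then 2*pi else 0)) = (\<lambda>k. if k = n then 2*pi * a n else 0)"
    by auto
  ultimately have "(\<lambda>k. if k = n then 2*pi * a n else 0) sums (LINT z|circ. (\<Sum>k. a k * z powi (int k - int n)))"
    by simp
  from sums_unique2[OF this sums_single[of n "\<lambda>_. 2*pi * a n"]]
  have I: "(LINT z|circ. (\<Sum>k. a k * z powi (int k - int n))) = 2*pi * a n" .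
  have "(LINT z|circ. (\<Sum>k. c k * disk_point (s, z) ^ k) * inv_point (s, z) ^ n)
      = (LINT z|circ. of_real (exp s) ^ n * (\<Sum>k. a k * z powi (int k - int n)))"
  proof (rule Bochner_Integration.integral_cong[OF refl])
    fix z assume "z \<in> space circ"
    then have z: "z * cnj z = 1" "z \<noteq> 0" "cmod z = 1" by (auto simp: complex_norm_square[symmetric])
    then have cz: "cnj z = inverse z" by (metis inverse_unique)
    have pw: "z powi (int k - int n) = z ^ k * cnj z ^ n" for k
      using z(2) unfolding cz by (simp add: power_int_diff power_inverse divide_inverse)
    have "cmod (disk_point (s, z)) < 1" using z s by (simp add: disk_point_def norm_mult)
    then have "(\<Sum>k. c k * disk_point (s, z) ^ k) * inv_point (s, z) ^ n = (\<Sum>k. c k * disk_point (s, z) ^ k * inv_point (s, z) ^ n)"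
      by (intro suminf_mult2 power_series_summable(1)[OF B])
    also have "(\<lambda>k. c k * disk_point (s, z) ^ k * inv_point (s, z) ^ n) = (\<lambda>k. of_real (exp s) ^ n * (a k * z powi (int k - int n)))"
      unfolding pw disk_point_def inv_point_def a_def power_mult_distrib fst_conv snd_conv by (simp only: mult_ac)
    also have "(\<Sum>k. of_real (exp s) ^ n * (a k * z powi (int k - int n))) = of_real (exp s) ^ n * (\<Sum>k. a k * z powi (int k - int n))"
    proof (rule suminf_mult)
      have g: "summable (\<lambda>k. B * exp (- s) ^ k)"
        by (intro summable_mult summable_geometric) (use s in simp)
      have "norm (cmod (a k * z powi (int k - int n))) \<le> B * exp (- s) ^ k" for k
        using a_le[of k] z(3) by (simp add: norm_mult norm_power_int)
      then have "summable (\<lambda>k. cmod (a k * z powi (int k - int n)))"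
        by (rule summable_comparison_test'[OF g])
      then show "summable (\<lambda>k. a k * z powi (int k - int n))" by (rule summable_norm_cancel)
    qed
    finally show "(\<Sum>k. c k * disk_point (s, z) ^ k) * inv_point (s, z) ^ n = of_real (exp s) ^ n * (\<Sum>k. a k * z powi (int k - int n))" .
  qed
  also have "\<dots> = of_real (exp s) ^ n * (2*pi * a n)"
    unfolding integral_mult_right_zero I ..
  also have "\<dots> = 2*pi * c n"
    by (simp add: a_def power_mult_distrib[symmetric] flip: of_real_mult exp_add)
  finally show ?thesis .
qed

text \<open>The relevant \<open>w\<close> has modulus \<open>exp (fst y - s)\<close>, so the two
  cases of \<open>integral_circ_kernel\<close> become the order in time: only sources farther out in
  the disk than the circle contribute.\<close>

lemma integral_circ_cauchy_kernel:
  assumes y: "cmod (snd y) = 1" and s: "s \<noteq> fst y"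
  shows "(LINT z|circ. inv_point (s, z) ^ n * cauchy_kernel (s, z) y) = (if fst y < s then 2*pi * inv_point y ^ n else 0)"
proof -
  define w where "w = of_real (exp (- s)) * inv_point y"
  have cw: "cmod w = exp (fst y - s)"
    using y by (simp add: w_def inv_point_def norm_mult exp_diff exp_minus divide_inverse norm_inverse)
  have "(LINT z|circ. inv_point (s, z) ^ n * cauchy_kernel (s, z) y) = (LINT z|circ. of_real (exp s) ^ n * (cnj z ^ n / (1 - z * w)))"
    by (intro Bochner_Integration.integral_cong refl)
      (simp add: inv_point_def[of "(s, _)"] cauchy_kernel_def disk_point_def w_def power_mult_distrib mult_ac)
  also have "\<dots> = of_real (exp s) ^ n * (LINT z|circ. cnj z ^ n / (1 - z * w))"
    by (rule integral_mult_right_zero)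
  also have "(LINT z|circ. cnj z ^ n / (1 - z * w)) = (if cmod w < 1 then 2*pi * w ^ n else 0)"
    by (rule integral_circ_kernel) (use cw s in simp)
  also have "of_real (exp s) ^ n * \<dots> = (if fst y < s then 2*pi * inv_point y ^ n else 0)"
  proof (cases "fst y < s")
    case True
    have "of_real (exp s) ^ n * w ^ n = (of_real (exp s * exp (- s)) * inv_point y) ^ n"
      by (simp add: w_def power_mult_distrib)
    then show ?thesis using True by (simp add: cw exp_minus mult.left_commute)
  qed (simp add: cw)
  finally show ?thesis .
qed

text \<open>For \<open>T > 0\<close>: 1 up to \<open>T/2\<close>, linear down to 0 at
  \<open>T\<close>, then 0. Its derivative is a multiple of an indicator, which is why it arises by
  integrating a step function in \<open>integral_cutoff\<close>.\<close>

definition cutoff :: "real \<Rightarrow> real \<Rightarrow> real" where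
  "cutoff T s = 2 / T * max 0 (T - max (T / 2) s)"

lemma cutoff_measurable [measurable]: "cutoff T \<in> borel_measurable borel"
  unfolding cutoff_def by measurable

lemma cutoff_bounds: "0 < T \<Longrightarrow> 0 \<le> cutoff T s" "0 < T \<Longrightarrow> cutoff T s \<le> 1" "T \<le> s \<Longrightarrow> cutoff T s = 0"
  by (auto simp: cutoff_def field_simps max_def)

lemma integral_cutoff:
  assumes "0 < T"
  shows "(LINT t|lborel. indicator {T/2..T} t * (if s < t then 1 else 0 :: real)) = T / 2 * cutoff T s"
proof -
  have "(LINT t|lborel. indicator {T/2..T} t * (if s < t then 1 else 0 :: real)) = (LINT t|lborel. indicator {max (T/2) s..T} t)"
  proof (rule Bochner_Integration.integral_cong_AE)
    show "AE t in lborel. indicator {T/2..T} t * (if s < t then 1 else 0 :: real) = indicator {max (T/2) s..T} t"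
      using AE_lborel_singleton[of s] by (rule eventually_mono) (auto simp: indicator_def)
  qed measurable
  also have "\<dots> = max 0 (T - max (T/2) s)"
    by (auto simp: max_def)
  finally show ?thesis using assms by (simp add: cutoff_def)
qed

text \<open>Integrability is not assumed: otherwise the integral is 0 by convention.\<close>

lemma ennreal_norm_integral_le:
  fixes f :: "'a \<Rightarrow> 'b::{banach, second_countable_topology}"
  shows "ennreal (norm (integral\<^sup>L M f)) \<le> (\<integral>\<^sup>+x. norm (f x) \<partial>M)"
  by (cases "integrable M f") (auto simp: integral_norm_bound_ennreal not_integrable_integral_eq)

section \<open>Square integrability and moments of the potential on the strip\<close>

lemma potential_disk_point: "potential U (disk_point x) = (LINT y|cyl. U y * cauchy_kernel x y)"
  by (simp add: potential_def cauchy_kernel_def)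

lemma potential_measurable [measurable]:
  assumes [measurable]: "U \<in> borel_measurable cyl"
  shows "(\<lambda>x. potential U (disk_point x)) \<in> borel_measurable cyl"
  unfolding potential_disk_point by measurable

lemma square_integrable_potential:
  assumes U: "square_integrable cyl U" and U0: "\<And>p. fst p \<notin> {0..R} \<Longrightarrow> U p = 0"
    and T: "0 < T" "T \<le> R"
  shows "square_integrable cyl (\<lambda>x. indicator {T/2..T} (fst x) *\<^sub>R potential U (disk_point x))" (is "square_integrable cyl ?h")
proof -
  have [measurable]: "U \<in> borel_measurable cyl" using U by (simp add: square_integrable_def)
  have "(\<integral>\<^sup>+x. ennreal (norm ((cmod (?h x))\<^sup>2)) \<partial>cyl) \<le> (\<integral>\<^sup>+x. indicator {0..R} (fst x) * (abs_potential U x)\<^sup>2 \<partial>cyl)"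
  proof (rule nn_integral_mono)
    fix x
    have "ennreal (cmod (potential U (disk_point x))) \<le> abs_potential U x"
      unfolding potential_disk_point abs_potential_def by (rule ennreal_norm_integral_le)
    then have "ennreal (cmod (potential U (disk_point x))) ^ 2 \<le> (abs_potential U x)\<^sup>2"
      by (rule power_mono) simp
    then show "ennreal (norm ((cmod (?h x))\<^sup>2)) \<le> indicator {0..R} (fst x) * (abs_potential U x)\<^sup>2"
      using T by (auto simp: indicator_def ennreal_power)
  qed
  also have "\<dots> < \<infinity>" by (rule nn_integral_abs_potential_finite[OF U U0])
  finally show ?thesis
    unfolding square_integrable_def integrable_iff_bounded by auto
qed

text \<open>Needed for Fubini in \<open>potential_moment\<close>. As a <= 1 + a^2 and the strip has
  finite measure, the square bound on \<open>abs_potential\<close> controls its first power.\<close>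

lemma integrable_potential_kernel:
  assumes U: "square_integrable cyl U" and U0: "\<And>p. fst p \<notin> {0..R} \<Longrightarrow> U p = 0"
    and T: "0 < T" "T \<le> R"
  shows "integrable (cyl \<Otimes>\<^sub>M cyl)
    (\<lambda>(x, y). indicator {T/2..T} (fst x) *\<^sub>R (inv_point x ^ n * (U y * cauchy_kernel x y)))" (is "integrable _ (\<lambda>(x, y). ?Q x y)")
proof (rule integrableI_bounded)
  have [measurable]: "U \<in> borel_measurable cyl" using U by (simp add: square_integrable_def)
  show "(\<lambda>(x, y). ?Q x y) \<in> borel_measurable (cyl \<Otimes>\<^sub>M cyl)" by measurable
  let ?I = "\<lambda>x. indicator {0..R} (fst x) :: ennreal"
  have "(\<integral>\<^sup>+p. norm (case p of (x, y) \<Rightarrow> ?Q x y) \<partial>(cyl \<Otimes>\<^sub>M cyl)) = (\<integral>\<^sup>+x. \<integral>\<^sup>+y. norm (?Q x y) \<partial>cyl \<partial>cyl)"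
    by (subst cyl.nn_integral_fst[symmetric]) (auto simp: case_prod_beta)
  also have "\<dots> \<le> (\<integral>\<^sup>+x. ennreal (exp T ^ n) * (?I x + ?I x * (abs_potential U x)\<^sup>2) \<partial>cyl)"
  proof (rule nn_integral_mono)
    fix x assume x: "x \<in> space cyl"
    then have [measurable]: "cauchy_kernel x \<in> borel_measurable cyl" unfolding cauchy_kernel_def by measurable
    show "(\<integral>\<^sup>+y. norm (?Q x y) \<partial>cyl) \<le> ennreal (exp T ^ n) * (?I x + ?I x * (abs_potential U x)\<^sup>2)"
    proof (cases "fst x \<in> {T/2..T}")
      case True
      then have xT: "fst x \<in> {0..T}" using T by auto
      have "(\<integral>\<^sup>+y. norm (?Q x y) \<partial>cyl) = (\<integral>\<^sup>+y. ennreal (cmod (inv_point x ^ n)) * ennreal (cmod (U y * cauchy_kernel x y)) \<partial>cyl)"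
        using True by (simp add: norm_mult ennreal_mult)
      also have "\<dots> = ennreal (cmod (inv_point x ^ n)) * abs_potential U x"
        unfolding abs_potential_def by (rule nn_integral_cmult) measurable
      also have "\<dots> \<le> ennreal (exp T ^ n) * (1 + (abs_potential U x)\<^sup>2)"
      proof (rule mult_mono)
        show "ennreal (cmod (inv_point x ^ n)) \<le> ennreal (exp T ^ n)"
          by (intro ennreal_leI cmod_inv_point_power xT) (use x in \<open>auto simp: space_pair_measure\<close>)
        show "abs_potential U x \<le> 1 + (abs_potential U x)\<^sup>2"
        proof (cases "abs_potential U x \<le> 1")
          case False
          then have "abs_potential U x * 1 \<le> abs_potential U x * abs_potential U x"
            by (intro mult_left_mono) auto
          then show ?thesis by (simp add: power2_eq_square add_increasing)
        qed (simp add: add_increasing2)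
      qed auto
      finally show ?thesis using xT T by (simp add: indicator_def)
    qed simp
  qed
  also have "\<dots> = ennreal (exp T ^ n) * (\<integral>\<^sup>+x. ?I x + ?I x * (abs_potential U x)\<^sup>2 \<partial>cyl)"
    by (rule nn_integral_cmult) measurable
  also have "(\<integral>\<^sup>+x. ?I x + ?I x * (abs_potential U x)\<^sup>2 \<partial>cyl) = (\<integral>\<^sup>+x. ?I x \<partial>cyl) + (\<integral>\<^sup>+x. ?I x * (abs_potential U x)\<^sup>2 \<partial>cyl)"
    by (rule nn_integral_add) measurable
  also have "(\<integral>\<^sup>+x. ?I x \<partial>cyl) = (\<integral>\<^sup>+x. indicator ({0..R} \<times> space circ) x \<partial>cyl)"
    by (rule nn_integral_cong) (auto simp: indicator_def space_pair_measure)
  also have "\<dots> = emeasure cyl ({0..R} \<times> space circ)"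
    by (rule nn_integral_indicator) (rule pair_measureI[OF _ sets.top], simp)
  also have "ennreal (exp T ^ n) * (emeasure cyl ({0..R} \<times> space circ) + (\<integral>\<^sup>+x. ?I x * (abs_potential U x)\<^sup>2 \<partial>cyl)) < \<infinity>"
    using nn_integral_abs_potential_finite[where R = R, OF U U0] emeasure_strip[of 0 R]
    by (simp add: ennreal_mult_less_top ennreal_mult_eq_top_iff less_top[symmetric] del: space_circ)
  finally show "(\<integral>\<^sup>+p. norm (case p of (x, y) \<Rightarrow> ?Q x y) \<partial>(cyl \<Otimes>\<^sub>M cyl)) < \<infinity>" .
qed

text \<open>After exchanging the integrals, each source \<open>y\<close> contributes a step function
  of \<open>s\<close>; its integral over \<open>{T/2..T}\<close> is
  \<open>T / 2 * cutoff T (fst y)\<close>, and the circle integral adds the factor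
  \<open>2*pi\<close>.\<close>

lemma potential_moment:
  assumes U: "square_integrable cyl U" and U0: "\<And>p. fst p \<notin> {0..R} \<Longrightarrow> U p = 0"
    and T: "0 < T" "T \<le> R"
  shows "(LINT x|cyl. indicator {T/2..T} (fst x) *\<^sub>R potential U (disk_point x) * inv_point x ^ n)
    = pi * T * (LINT y|cyl. of_real (cutoff T (fst y)) * U y * inv_point y ^ n)"
proof -
  interpret CC: pair_sigma_finite cyl cyl ..
  define Q where "Q x y = indicator {T/2..T} (fst x) *\<^sub>R (inv_point x ^ n * (U y * cauchy_kernel x y))" for x y
  have iQ: "integrable (cyl \<Otimes>\<^sub>M cyl) (\<lambda>(x, y). Q x y)"
    unfolding Q_def by (rule integrable_potential_kernel[OF U U0 T])
  have [measurable]: "U \<in> borel_measurable cyl" using U by (simp add: square_integrable_def)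
  have "(LINT x|cyl. indicator {T/2..T} (fst x) *\<^sub>R potential U (disk_point x) * inv_point x ^ n) = (LINT x|cyl. LINT y|cyl. Q x y)"
    unfolding Q_def potential_disk_point integral_scaleR_right integral_mult_right_zero by (simp add: mult.commute)
  also have "\<dots> = (LINT y|cyl. LINT x|cyl. Q x y)"
    by (rule CC.Fubini_integral[OF iQ, symmetric])
  also have "\<dots> = (LINT y|cyl. (pi * T) * (of_real (cutoff T (fst y)) * U y * inv_point y ^ n))"
  proof (rule Bochner_Integration.integral_cong_AE)
    show "(\<lambda>y. LINT x|cyl. Q x y) \<in> borel_measurable cyl"
      unfolding Q_def by measurable
    show "(\<lambda>y. (pi * T) * (of_real (cutoff T (fst y)) * U y * inv_point y ^ n)) \<in> borel_measurable cyl"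
      by measurable
    show "AE y in cyl. (LINT x|cyl. Q x y) = (pi * T) * (of_real (cutoff T (fst y)) * U y * inv_point y ^ n)"
      using CC.AE_integrable_snd[OF iQ]
    proof (rule AE_mp, intro AE_I2 impI)
      fix y assume y: "y \<in> space cyl" and iy: "integrable cyl (\<lambda>x. Q x y)"
      have y1: "cmod (snd y) = 1" using y by (auto simp: space_pair_measure)
      have "(LINT x|cyl. Q x y) = (LINT s|lborel. LINT z|circ. Q (s, z) y)"
        by (rule cyl.integral_fst'[OF iy, symmetric])
      also have "\<dots> = (LINT s|lborel. of_real (indicator {T/2..T} s * (if fst y < s then 1 else 0)) * (U y * (2*pi * inv_point y ^ n)))"
      proof (rule Bochner_Integration.integral_cong_AE)
        show "(\<lambda>s. LINT z|circ. Q (s, z) y) \<in> borel_measurable lborel"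
          by (rule borel_measurable_integrable[OF cyl.integrable_fst'[OF iy]])
        have "(LINT z|circ. Q (s, z) y) = of_real (indicator {T/2..T} s * (if fst y < s then 1 else 0)) * (U y * (2*pi * inv_point y ^ n))"
          if "s \<noteq> fst y" for s
        proof -
          have "(LINT z|circ. Q (s, z) y) = (LINT z|circ. (of_real (indicator {T/2..T} s) * U y) * (inv_point (s, z) ^ n * cauchy_kernel (s, z) y))"
            unfolding Q_def by (simp add: scaleR_conv_of_real mult_ac)
          also have "\<dots> = (of_real (indicator {T/2..T} s) * U y) * (LINT z|circ. inv_point (s, z) ^ n * cauchy_kernel (s, z) y)"
            by (rule integral_mult_right_zero)
          finally show ?thesis unfolding integral_circ_cauchy_kernel[OF y1 that] by simp
        qed
        then show "AE s in lborel. (LINT z|circ. Q (s, z) y) = of_real (indicator {T/2..T} s * (if fst y < s then 1 else 0)) * (U y * (2*pi * inv_point y ^ n))"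
          using AE_lborel_singleton[of "fst y"] by (auto elim: eventually_mono)
      qed measurable
      also have "\<dots> = of_real (T / 2 * cutoff T (fst y)) * (U y * (2*pi * inv_point y ^ n))"
        unfolding integral_mult_left_zero integral_complex_of_real integral_cutoff[OF T(1)] ..
      also have "\<dots> = (pi * T) * (of_real (cutoff T (fst y)) * U y * inv_point y ^ n)"
        by (simp add: mult_ac)
      finally show "(LINT x|cyl. Q x y) = (pi * T) * (of_real (cutoff T (fst y)) * U y * inv_point y ^ n)" .
    qed
  qed
  also have "\<dots> = pi * T * (LINT y|cyl. of_real (cutoff T (fst y)) * U y * inv_point y ^ n)"
    using integral_mult_right_zero[of cyl "complex_of_real (pi * T)"] by simp
  finally show ?thesis .
qed

text \<open>The order of \<open>T\<close> and \<open>T'\<close> does not matter to the construction,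
  so this one inclusion, used in both directions, is the theorem.\<close>

lemma NC_H2_subset_any_time:
  assumes \<omega>: "open_strict_interval \<omega>" and T: "0 < T" "0 < T'" and f0: "f0 \<in> NC_H2 \<omega> T'"
  shows "f0 \<in> NC_H2 \<omega> T"
proof -
  obtain C where C: "closed C" "C \<subseteq> sphere 0 1" "\<omega> \<subseteq> C" and \<omega>m: "\<omega> \<in> sets circ"
    and bdry: "AE z in circ. z \<in> C \<longrightarrow> z \<in> \<omega>"
    by (rule open_strict_interval_closure[OF \<omega>])
  obtain u where f0H: "f0 \<in> H2" and u: "is_control \<omega> T' u" and sol: "H2_solution \<omega> u f0 T' = 0"
    using f0 by (auto simp: NC_H2_def)
  \<comment> \<open>A common horizon containing the given control and the strip of the cutoff,
    whichever of \<open>T\<close> and \<open>T'\<close> is larger.\<close>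
  define R where "R = max T T'"
  have R: "T \<le> R" "T' \<le> R" by (auto simp: R_def)
  define U where "U p = (if p \<in> {0..T'} \<times> \<omega> then u p else 0)" for p
  have U: "square_integrable cyl U"
    using u unfolding is_control_iff[OF \<omega>m] U_def .
  have Um [measurable]: "U \<in> borel_measurable cyl" using U by (simp add: square_integrable_def)
  have U0: "U p = 0" if "fst p \<notin> {0..R} \<or> snd p \<notin> C" for p
    using that C(3) R by (auto simp: U_def)
  have U0': "U p = 0" if "fst p \<notin> {0..R}" for p using U0 that by blast
  define c where "c n = 2*pi * fourier_coeff f0 (int n)" for n
  have mom: "c n + (LINT p|cyl. U p * inv_point p ^ n) = 0" for n
    using sol unfolding H2_solution_eq_0_iff[OF \<omega>m less_imp_le[OF T(2)] f0H u] U_def c_def by blast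
  have B: "cmod (c n) \<le> 2*pi * norm f0" for n
  proof -
    have "(cmod (fourier_coeff f0 (int n)))\<^sup>2 \<le> 2*pi * (cmod (fourier_coeff f0 (int n)))\<^sup>2"
      using pi_gt3 by (simp add: mult_le_cancel_right1)
    also have "\<dots> \<le> (norm f0)\<^sup>2" using bessel[of "{int n}" f0] by simp
    finally have "cmod (fourier_coeff f0 (int n)) \<le> norm f0" by (rule power2_le_imp_le) simp
    then show ?thesis by (simp add: c_def norm_mult)
  qed
  define F where "F p = (\<Sum>n. c n * disk_point p ^ n)" for p
  have Fm [measurable]: "F \<in> borel_measurable cyl" unfolding F_def by measurable
  define hF where "hF p = indicator {T/2..T} (fst p) *\<^sub>R F p" for p
  define hP where "hP p = indicator {T/2..T} (fst p) *\<^sub>R potential U (disk_point p)" for p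
  define hU where "hU p = of_real (cutoff T (fst p)) * U p" for p
  \<comment> \<open>This is chi u + chi' G with chi' = \<open>- 2 / T\<close> on the strip and
    \<open>2*pi\<close> G equal to \<open>F\<close> plus the potential; hence the constant
    \<open>1 / (pi * T)\<close>.\<close>
  define V where "V p = hU p - of_real (1 / (pi * T)) * (hF p + hP p)" for p
  have hF: "square_integrable cyl hF"
    unfolding hF_def
  proof (rule square_integrable_strip[OF Fm])
    fix p :: "real \<times> complex" assume p: "fst p \<in> {T/2..T}" "cmod (snd p) = 1"
    have d: "cmod (disk_point p) \<le> exp (- (T/2))" "exp (- (T/2)) < 1"
      using p T by (auto simp: disk_point_def norm_mult)
    then have d1: "cmod (disk_point p) < 1" by linarith
    have "cmod (F p) \<le> 2*pi * norm f0 / (1 - cmod (disk_point p))"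
      unfolding F_def by (rule power_series_summable(2)[OF B d1])
    also have "\<dots> \<le> 2*pi * norm f0 / (1 - exp (- (T/2)))"
      using d d1 by (intro divide_left_mono mult_pos_pos) auto
    finally show "cmod (F p) \<le> 2*pi * norm f0 / (1 - exp (- (T/2)))" .
  qed
  have hP: "square_integrable cyl hP"
    unfolding hP_def by (rule square_integrable_potential[where R = R, OF U U0' T(1) R(1)])
  have hU: "square_integrable cyl hU"
  proof (rule square_integrable_bound)
    show "integrable cyl (\<lambda>p. (cmod (U p))\<^sup>2)" using U by (simp add: square_integrable_def)
    have "cmod (hU p) \<le> cmod (U p)" for p
      using cutoff_bounds(1,2)[OF T(1), of "fst p"] by (simp add: hU_def norm_mult mult_left_le_one_le)
    then show "AE p in cyl. (cmod (hU p))\<^sup>2 \<le> (cmod (U p))\<^sup>2"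
      by (intro AE_I2 power_mono) auto
  qed (unfold hU_def, measurable)
  have V: "square_integrable cyl V"
    unfolding V_def by (intro square_integrable_diff square_integrable_cmult square_integrable_add hF hP hU)
  have supp: "hF p = 0" "hP p = 0" if "fst p \<notin> {0..T}" for p
    using that T by (auto simp: hF_def hP_def)
  have suppU: "hU p = 0" if "fst p \<notin> {0..R}" for p
    using U0'[OF that] by (simp add: hU_def)
  have [measurable]: "(\<lambda>p. inv_point p ^ n) \<in> borel_measurable cyl" for n
    by measurable
  have iF: "integrable cyl (\<lambda>p. hF p * inv_point p ^ n)" for n
    by (rule square_integrable_times_bounded[OF hF supp(1) _ cmod_inv_point_power]) measurable
  have iP: "integrable cyl (\<lambda>p. hP p * inv_point p ^ n)" for n
    by (rule square_integrable_times_bounded[OF hP supp(2) _ cmod_inv_point_power]) measurable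
  have iU: "integrable cyl (\<lambda>p. hU p * inv_point p ^ n)" for n
    by (rule square_integrable_times_bounded[OF hU suppU _ cmod_inv_point_power]) measurable
  have momF: "(LINT p|cyl. hF p * inv_point p ^ n) = pi * T * c n" for n
  proof -
    have "(LINT p|cyl. hF p * inv_point p ^ n) = (LINT s|lborel. LINT z|circ. hF (s, z) * inv_point (s, z) ^ n)"
      by (rule cyl.integral_fst'[OF iF, symmetric])
    also have "\<dots> = (LINT s|lborel. indicator {T/2..T} s *\<^sub>R (2*pi * c n))"
    proof (rule Bochner_Integration.integral_cong[OF refl])
      fix s
      show "(LINT z|circ. hF (s, z) * inv_point (s, z) ^ n) = indicator {T/2..T} s *\<^sub>R (2*pi * c n)"
      proof (cases "s \<in> {T/2..T}")
        case True
        then have "s > 0" using T by auto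
        from integral_circ_power_series[where n = n, OF B this] show ?thesis
          using True by (simp add: hF_def F_def)
      qed (simp add: hF_def)
    qed
    also have "\<dots> = (T/2) *\<^sub>R (2*pi * c n)"
      using T by simp
    finally show ?thesis by (simp add: scaleR_conv_of_real)
  qed
  have momV: "(LINT p|cyl. V p * inv_point p ^ n) = - c n" for n
  proof -
    have "(LINT p|cyl. V p * inv_point p ^ n)
        = (LINT p|cyl. hU p * inv_point p ^ n - of_real (1 / (pi * T)) * (hF p * inv_point p ^ n + hP p * inv_point p ^ n))"
      unfolding V_def left_diff_distrib mult.assoc distrib_right ..
    also have "\<dots> = (LINT p|cyl. hU p * inv_point p ^ n) - of_real (1 / (pi * T)) *
        ((LINT p|cyl. hF p * inv_point p ^ n) + (LINT p|cyl. hP p * inv_point p ^ n))"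
      by (simp only: Bochner_Integration.integral_diff[OF iU integrable_mult_right[OF Bochner_Integration.integrable_add[OF iF iP]]]
          integral_mult_right_zero Bochner_Integration.integral_add[OF iF iP])
    also have "(LINT p|cyl. hP p * inv_point p ^ n) = pi * T * (LINT p|cyl. hU p * inv_point p ^ n)"
      unfolding hP_def hU_def by (rule potential_moment[where R = R, OF U U0' T(1) R(1)])
    finally show ?thesis
      unfolding momF using T by (simp add: field_simps)
  qed
  \<comment> \<open>\<open>W\<close> is the part of \<open>V\<close> that acts as a control. It must
    agree with \<open>V\<close> almost everywhere, otherwise the moments of \<open>V\<close> would
    say nothing about it.\<close>
  define W where "W p = (if p \<in> {0..T} \<times> \<omega> then V p else 0)" for p
  have Cm: "C \<in> sets circ"
    using C by (simp add: sets_restrict_space_iff borel_closed)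
  have ae: "AE p in cyl. W p = V p"
  proof -
    note [measurable] = \<omega>m Cm
    have "AE p in cyl. snd p \<in> C \<longrightarrow> snd p \<in> \<omega>"
    proof (rule cyl.AE_pair_measure)
      show "{p \<in> space cyl. snd p \<in> C \<longrightarrow> snd p \<in> \<omega>} \<in> sets cyl" by measurable
    qed (use bdry in simp)
    then show ?thesis
    proof (rule AE_mp, intro AE_I2 impI)
      fix p assume p: "p \<in> space cyl" "snd p \<in> C \<longrightarrow> snd p \<in> \<omega>"
      show "W p = V p"
      proof (cases "p \<in> {0..T} \<times> \<omega>")
        case False
        \<comment> \<open>After time \<open>T\<close> the cutoff vanishes; up to time
          \<open>T\<close>, the point is at a negative time or off the arc, where \<open>U\<close>
          vanishes.\<close>
        have "hU p = 0"
          using False cutoff_bounds(3)[of T "fst p"] by (cases "fst p \<le> T") (auto simp: hU_def U_def mem_Times_iff)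
        moreover have "hF p + hP p = 0"
        proof (cases "fst p \<in> {T/2..T}")
          case True
          then have "fst p > 0" "snd p \<notin> C" using False p(2) T by (auto simp: mem_Times_iff)
          then have "F p + potential U (disk_point p) = 0"
            unfolding F_def
            by (intro potential_eq_0[where R = R and C = C and B = "2*pi * norm f0"] U U0 C B mom)
              (use p(1) in \<open>auto simp: space_pair_measure\<close>)
          then show ?thesis by (simp add: hF_def hP_def scaleR_add_right[symmetric])
        qed (simp add: hF_def hP_def)
        ultimately show ?thesis using False by (simp add: W_def V_def)
      qed (simp add: W_def)
    qed
  qed
  have Vm [measurable]: "V \<in> borel_measurable cyl" using V by (simp add: square_integrable_def)
  have Wm [measurable]: "W \<in> borel_measurable cyl"
  proof -
    note [measurable] = \<omega>m
    show ?thesis unfolding W_def by measurable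
  qed
  have "square_integrable cyl W"
  proof (rule square_integrable_bound[OF Wm])
    show "integrable cyl (\<lambda>p. (cmod (V p))\<^sup>2)" using V by (simp add: square_integrable_def)
  qed (simp add: W_def)
  then have ctrl: "is_control \<omega> T V"
    unfolding is_control_iff[OF \<omega>m] W_def .
  have "(LINT p|cyl. W p * inv_point p ^ n) = (LINT p|cyl. V p * inv_point p ^ n)" for n
    by (rule Bochner_Integration.integral_cong_AE) (use ae in auto)
  then have "H2_solution \<omega> V f0 T = 0"
    unfolding H2_solution_eq_0_iff[OF \<omega>m less_imp_le[OF T(1)] f0H ctrl] W_def[symmetric] momV
    by (simp add: c_def)
  then show ?thesis
    using f0H ctrl by (auto simp: NC_H2_def)
qed

theorem theorem1p3:
  fixes \<omega> :: "complex set" and T T' :: real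
  assumes "open_strict_interval \<omega>" and "0 < T" and "0 < T'"
  shows "NC_H2 \<omega> T = NC_H2 \<omega> T'"
  using NC_H2_subset_any_time assms by blast

end
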